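(* Let $\mathcal{L}$ be a countable first-order language and let $\mathcal{N}\in\mathrm{Str}(\mathcal{L},\mathbb{N})$ be a structure which is not highly algebraic. Then $[\mathcal{N}]_{\mathrm{iso}}$ is the support of a $\mathrm{Sym}(\mathbb{N})$-quasi-invariant Borel probability measure $\mu$ on $\mathrm{Str}(\mathcal{L},\mathbb{N})$ whose Radon–Nikodym cocycle $c_\mu$ has the property that, for each $\mathcal{M}\in\mathrm{Str}(\mathcal{L},\mathbb{N})$, the map $c_\mu(-,\mathcal{M})\colon\mathrm{Sym}(\mathbb{N})\to\mathbb{R}$ is continuous.
   Context: A countable language $\mathcal{L}$ is a countable set of relation and function symbols with finite arities. $\mathrm{Str}(\mathcal{L},\mathbb{N})$ is the Polish space of $\mathcal{L}$-structures with domain $\mathbb{N}$ (identified with $\prod_{R}2^{\mathbb{N}^{n(R)}}\times\prod_{f}\mathbb{N}^{\mathbb{N}^{n(f)}}$), on which $\mathrm{Sym}(\mathbb{N})$ acts by the logic action $g_*\mathcal{M}\models R(\bar a)\iff\mathcal{M}\models R(g^{-1}\bar a)$, $g_*\mathcal{M}\models b=f(\bar a)\iff \mathcal{M}\models g^{-1}b=f(g^{-1}\bar a)$. $[\mathcal{N}]_{\mathrm{iso}}$ is the set of structures in $\mathrm{Str}(\mathcal{L},\mathbb{N})$ isomorphic to $\mathcal{N}$. A measure $\mu$ is $\mathrm{Sym}(\mathbb{N})$-quasi-invariant if $\mu(B)=0\iff\mu(gB)=0$ for all Borel $B$ and $g\in\mathrm{Sym}(\mathbb{N})$; its Radon–Nikodym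 cocycle $c_\mu\colon\mathrm{Sym}(\mathbb{N})\times\mathrm{Str}(\mathcal{L},\mathbb{N})\to\mathbb{R}$ is the measurable cocycle given by the Radon–Nikodym derivatives $c_\mu(g,\mathcal{M})=\frac{d(g_*\mu)}{d\mu}(\mathcal{M})$. For a tuple $\bar a$ in the domain, $\mathrm{acl}(\bar a,\mathcal{N})$ is the set of elements with finite orbit under the pointwise stabilizer $\mathrm{Aut}(\mathcal{N})_{\bar a}$. $\mathcal{N}$ is highly algebraic if for every finite $F\subseteq\mathrm{dom}(\mathcal{N})$ there is a tuple $\bar a=(a_0,\dots,a_{n-1})$ with $\mathrm{acl}(\bar a,\mathcal{N})\not\subseteq F\cup\{a_0,\dots,a_{n-1}\}$. *)

theory Defs
  imports "HOL-Probability.Probability"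
begin

record ('r, 'f) language =
  Rel :: "'r set"
  Fun :: "'f set"
  rel_ar :: "'r \<Rightarrow> nat"
  fun_ar :: "'f \<Rightarrow> nat"

definition countable_language :: "('r, 'f) language \<Rightarrow> bool" where
  "countable_language L \<longleftrightarrow> countable (Rel L) \<and> countable (Fun L)"

(* The interpretations of the relation symbols and of the function symbols.  Tuples are lists. *)
type_synonym ('r, 'f) struct =
  "('r \<Rightarrow> nat list \<Rightarrow> bool) \<times> ('f \<Rightarrow> nat list \<Rightarrow> nat)"

definition tuples :: "nat \<Rightarrow> nat list set" where
  "tuples n = {xs. length xs = n}"

(* Interpretations are extensional, i.e. undefined at symbols outside L and at tuples of the
   wrong length, so that equality in Str L is equality of L-structures. *)
definition Str :: "('r, 'f) language \<Rightarrow> ('r, 'f) struct set" where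
  "Str L = (\<Pi>\<^sub>E R\<in>Rel L. tuples (rel_ar L R) \<rightarrow>\<^sub>E UNIV) \<times>
           (\<Pi>\<^sub>E f\<in>Fun L. tuples (fun_ar L f) \<rightarrow>\<^sub>E UNIV)"

definition Str_top :: "('r, 'f) language \<Rightarrow> ('r, 'f) struct topology" where
  "Str_top L = prod_topology
     (product_topology
        (\<lambda>R. product_topology (\<lambda>_. discrete_topology UNIV) (tuples (rel_ar L R))) (Rel L))
     (product_topology
        (\<lambda>f. product_topology (\<lambda>_. discrete_topology UNIV) (tuples (fun_ar L f))) (Fun L))"

lemma topspace_Str_top [simp]: "topspace (Str_top L) = Str L"
  by (simp add: Str_top_def Str_def)

definition Str_borel :: "('r, 'f) language \<Rightarrow> ('r, 'f) struct measure" where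
  "Str_borel L = sigma (Str L) {U. openin (Str_top L) U}"

lemma space_Str_borel [simp]: "space (Str_borel L) = Str L"
  unfolding Str_borel_def
  by (rule space_measure_of) (use openin_subset[of "Str_top L"] in auto)

lemma sets_Str_borel: "sets (Str_borel L) = sigma_sets (Str L) {U. openin (Str_top L) U}"
  unfolding Str_borel_def
  by (rule sets_measure_of) (use openin_subset[of "Str_top L"] in auto)

(* Topologised as a subspace of nat => nat, whose library topology is that of pointwise
   convergence with nat discrete. *)
definition Sym :: "(nat \<Rightarrow> nat) set" where
  "Sym = {g. bij g}"

definition logic_act ::
    "('r, 'f) language \<Rightarrow> (nat \<Rightarrow> nat) \<Rightarrow> ('r, 'f) struct \<Rightarrow> ('r, 'f) struct" where
  "logic_act L g M =
     ((\<lambda>R\<in>Rel L. \<lambda>xs\<in>tuples (rel_ar L R). fst M R (map (inv g) xs)),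
      (\<lambda>f\<in>Fun L. \<lambda>xs\<in>tuples (fun_ar L f). g (snd M f (map (inv g) xs))))"

definition is_iso ::
    "('r, 'f) language \<Rightarrow> (nat \<Rightarrow> nat) \<Rightarrow> ('r, 'f) struct \<Rightarrow> ('r, 'f) struct \<Rightarrow> bool" where
  "is_iso L g M N \<longleftrightarrow> bij g \<and>
     (\<forall>R\<in>Rel L. \<forall>xs\<in>tuples (rel_ar L R). fst M R xs \<longleftrightarrow> fst N R (map g xs)) \<and>
     (\<forall>f\<in>Fun L. \<forall>xs\<in>tuples (fun_ar L f). g (snd M f xs) = snd N f (map g xs))"

definition iso_class :: "('r, 'f) language \<Rightarrow> ('r, 'f) struct \<Rightarrow> ('r, 'f) struct set" where
  "iso_class L N = {M \<in> Str L. \<exists>g. is_iso L g M N}"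

definition Aut_stab ::
    "('r, 'f) language \<Rightarrow> ('r, 'f) struct \<Rightarrow> nat list \<Rightarrow> (nat \<Rightarrow> nat) set" where
  "Aut_stab L N as = {g. is_iso L g N N \<and> (\<forall>a\<in>set as. g a = a)}"

definition acl :: "('r, 'f) language \<Rightarrow> nat list \<Rightarrow> ('r, 'f) struct \<Rightarrow> nat set" where
  "acl L as N = {b. finite ((\<lambda>g. g b) ` Aut_stab L N as)}"

definition highly_algebraic :: "('r, 'f) language \<Rightarrow> ('r, 'f) struct \<Rightarrow> bool" where
  "highly_algebraic L N \<longleftrightarrow> (\<forall>F. finite F \<longrightarrow> (\<exists>as. \<not> acl L as N \<subseteq> F \<union> set as))"

(* The images are again Borel (logic_act_image_sets below), so the right-hand side is never 0
   merely because emeasure vanishes on non-measurable sets. *)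
definition quasi_invariant :: "('r, 'f) language \<Rightarrow> ('r, 'f) struct measure \<Rightarrow> bool" where
  "quasi_invariant L \<mu> \<longleftrightarrow> (\<forall>g\<in>Sym. \<forall>B\<in>sets (Str_borel L).
     emeasure \<mu> B = 0 \<longleftrightarrow> emeasure \<mu> (logic_act L g ` B) = 0)"

(* S need not be closed: S is the support when it carries the measure and no nonempty relatively
   open part of it lies in a null open set, so the closed support is then the closure of S. *)
definition is_support :: "'a topology \<Rightarrow> 'a measure \<Rightarrow> 'a set \<Rightarrow> bool" where
  "is_support X \<mu> S \<longleftrightarrow> S \<subseteq> topspace X \<and> (AE x in \<mu>. x \<in> S) \<and>
     (\<forall>U. openin X U \<longrightarrow> U \<inter> S \<noteq> {} \<longrightarrow> emeasure \<mu> U > 0)"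

(* For each g the derivative is determined only almost everywhere; c is a choice of versions
   satisfying the cocycle identity everywhere.  With c g = d(g_* mu)/d(mu), the chain rule gives
   the identity in the form c(gh, M) = c(g, M) c(h, g^-1 M).  Meaningful for quasi-invariant mu,
   which makes g_* mu absolutely continuous with respect to mu. *)
definition RN_cocycle ::
    "('r, 'f) language \<Rightarrow> ('r, 'f) struct measure \<Rightarrow>
     ((nat \<Rightarrow> nat) \<Rightarrow> ('r, 'f) struct \<Rightarrow> real) \<Rightarrow> bool" where
  "RN_cocycle L \<mu> c \<longleftrightarrow>
     (\<lambda>(g, M). c g M) \<in> borel_measurable (restrict_space borel Sym \<Otimes>\<^sub>M Str_borel L) \<and>
     (\<forall>g\<in>Sym. \<forall>M\<in>Str L. c g M > 0) \<and>
     (\<forall>g\<in>Sym. \<forall>h\<in>Sym. \<forall>M\<in>Str L.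
        c (g \<circ> h) M = c g M * c h (logic_act L (inv g) M)) \<and>
     (\<forall>g\<in>Sym. AE M in \<mu>.
        RN_deriv \<mu> (distr \<mu> (Str_borel L) (logic_act L g)) M = ennreal (c g M))"

lemma logic_act_in_Str: "logic_act L g M \<in> Str L"
  by (auto simp: logic_act_def Str_def)

lemma map_in_tuples [simp]: "map g xs \<in> tuples n \<longleftrightarrow> xs \<in> tuples n"
  by (simp add: tuples_def)

lemma logic_act_id: "M \<in> Str L \<Longrightarrow> logic_act L id M = M"
  by (cases M) (auto simp: logic_act_def Str_def PiE_iff extensional_def fun_eq_iff restrict_def)

lemma logic_act_comp:
  assumes "g \<in> Sym" "h \<in> Sym"
  shows "logic_act L g (logic_act L h M) = logic_act L (g \<circ> h) M"
  using assms by (auto simp: logic_act_def Sym_def o_inv_distrib fun_eq_iff restrict_def)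

lemma continuous_map_logic_act: "continuous_map (Str_top L) (Str_top L) (logic_act L g)"
proof -
  have r: "continuous_map (Str_top L) (discrete_topology UNIV) (\<lambda>M. fst M R xs)"
    if "R \<in> Rel L" "xs \<in> tuples (rel_ar L R)" for R xs
  proof -
    let ?X = "\<lambda>R. product_topology (\<lambda>_. discrete_topology UNIV) (tuples (rel_ar L R))"
    have "continuous_map (Str_top L) (product_topology ?X (Rel L)) fst"
      unfolding Str_top_def by (rule continuous_map_fst)
    from continuous_map_compose[OF this continuous_map_product_projection[OF that(1)]]
    have "continuous_map (Str_top L) (?X R) (\<lambda>M. fst M R)" by (simp add: o_def)
    from continuous_map_compose[OF this continuous_map_product_projection[OF that(2)]]
    show ?thesis by (simp add: o_def)
  qed
  have f: "continuous_map (Str_top L) (discrete_topology UNIV) (\<lambda>M. snd M f xs)"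
    if "f \<in> Fun L" "xs \<in> tuples (fun_ar L f)" for f xs
  proof -
    let ?X = "\<lambda>f. product_topology (\<lambda>_. discrete_topology UNIV) (tuples (fun_ar L f))"
    have "continuous_map (Str_top L) (product_topology ?X (Fun L)) snd"
      unfolding Str_top_def by (rule continuous_map_snd)
    from continuous_map_compose[OF this continuous_map_product_projection[OF that(1)]]
    have "continuous_map (Str_top L) (?X f) (\<lambda>M. snd M f)" by (simp add: o_def)
    from continuous_map_compose[OF this continuous_map_product_projection[OF that(2)]]
    show ?thesis by (simp add: o_def)
  qed
  have gf: "continuous_map (Str_top L) (discrete_topology UNIV) (\<lambda>M. g (snd M f xs))"
    if "f \<in> Fun L" "xs \<in> tuples (fun_ar L f)" for f xs
    using continuous_map_compose[OF f[OF that], of "discrete_topology UNIV" g]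
    by (simp add: o_def)
  show ?thesis
    unfolding Str_top_def[of L] logic_act_def
    apply (subst continuous_map_pairwise)
    apply (simp add: o_def continuous_map_componentwise flip: Str_top_def)
    using r gf by (auto simp: logic_act_def cong: if_cong)
qed

lemma measurable_logic_act [measurable]: "logic_act L g \<in> Str_borel L \<rightarrow>\<^sub>M Str_borel L"
  unfolding Str_borel_def
proof (rule measurable_measure_of)
  show "{U. openin (Str_top L) U} \<subseteq> Pow (Str L)"
    using openin_subset[of "Str_top L"] by auto
  show "logic_act L g \<in> space (sigma (Str L) {U. openin (Str_top L) U}) \<rightarrow> Str L"
    by (simp add: logic_act_in_Str)
  fix U assume "U \<in> {U. openin (Str_top L) U}"
  then have "openin (Str_top L) {M \<in> Str L. logic_act L g M \<in> U}"
    using openin_continuous_map_preimage[OF continuous_map_logic_act, of L U g] by simp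
  moreover have "logic_act L g -` U \<inter> Str L = {M \<in> Str L. logic_act L g M \<in> U}" by auto
  ultimately show "logic_act L g -` U \<inter> space (sigma (Str L) {U. openin (Str_top L) U})
      \<in> sets (sigma (Str L) {U. openin (Str_top L) U})"
    by (metis (no_types) Str_borel_def mem_Collect_eq sets_Str_borel sigma_sets.Basic space_Str_borel)
qed

lemma logic_act_image_sets:
  assumes g: "g \<in> Sym" and B: "B \<in> sets (Str_borel L)"
  shows "logic_act L g ` B \<in> sets (Str_borel L)"
proof -
  have g': "inv g \<in> Sym" "g \<circ> inv g = id" "inv g \<circ> g = id"
    using g by (auto simp: Sym_def bij_imp_bij_inv bij_is_surj surj_iff[symmetric]
        bij_is_inj inj_iff[symmetric])
  have sub: "B \<subseteq> Str L" using sets.sets_into_space[OF B] by simp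
  have "logic_act L g ` B = logic_act L (inv g) -` B \<inter> space (Str_borel L)"
  proof (intro equalityI subsetI)
    fix M assume "M \<in> logic_act L g ` B"
    then show "M \<in> logic_act L (inv g) -` B \<inter> space (Str_borel L)"
      using sub g g' by (auto simp: logic_act_comp logic_act_in_Str logic_act_id subset_iff)
  next
    fix M assume "M \<in> logic_act L (inv g) -` B \<inter> space (Str_borel L)"
    moreover from this have "M = logic_act L g (logic_act L (inv g) M)"
      using g g' by (simp add: logic_act_comp logic_act_id)
    ultimately show "M \<in> logic_act L g ` B" by blast
  qed
  then show ?thesis using measurable_sets[OF measurable_logic_act B] by simp
qed

end

theory Submission
  imports Defs
begin

text \<open>Let \<open>F\<close> be the set of all elements that are algebraic over some tuple not containing them.  As \<open>N\<close> is
  not highly algebraic, \<open>F\<close> is finite; it is invariant under \<open>Aut(N)\<close>, and over any finite set the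
  orbits of the elements outside \<open>F\<close> are infinite.  A random copy of \<open>N\<close> is built as follows.  Choose
  distinct positions for the elements of \<open>F\<close>, with probability proportional to the product of
  positive weights.  Every other position carries a random walk through \<open>N - F\<close>, the walks of
  different positions being independent and identically distributed: at each stage a coin decides
  whether the walk stays or jumps from \<open>a\<close> to \<open>s a\<close>, where any combination of jumps from a finite
  set of points is induced by an automorphism fixing \<open>F\<close>.  Hence the type of a tuple of positions
  with distinct values no longer changes, almost surely different positions are eventually
  separated, and since every point keeps being chosen as a starting point, a back-and-forth argument shows that
  the limit structure is isomorphic to \<open>N\<close>.  Permuting the positions outside those of \<open>F\<close> does not
  change the law, so that the Radon-Nikodym derivative is the quotient of the weights of the two sets
  of positions of \<open>F\<close>.  This depends on finitely many values of the permutation, and the set of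
  positions of \<open>F\<close> is a Borel equivariant function of the structure.\<close>

section \<open>Back-and-forth systems\<close>

text \<open>An element that is algebraic over a tuple of other elements has a finite orbit over that
  tuple, so it cannot be spread over infinitely many positions by independent identically
  distributed walks. This is why \<open>F\<close> gets separate positions; the price is invariance,
  and the whole density comes from the choice of these positions. With product weights the
  probability of a choice depends only on the set of chosen positions. That matters because
  automorphisms may permute \<open>F\<close>: the structure reveals which positions carry
  \<open>F\<close>, but not always which position carries which element. The walks themselves need
  not converge. What stabilises is the \<open>Aut(N)\<close>-orbit of the tuple of values at
  finitely many positions, and the random structure is read off from the eventual truth values.
  Witnesses for back-and-forth demands appear only at later stages, so walks must be able to start
  late, at a prescribed point and stage. Both "isomorphic to \<open>N\<close>" and "carries an
  element of \<open>F\<close>" mention an unknown isomorphism; predicates that separate the orbits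
  of tuples of \<open>N\<close> replace it and make both notions Borel.\<close>

lemma back_and_forth:
  fixes Rel :: "nat list \<Rightarrow> nat list \<Rightarrow> bool"
  assumes base: "Rel [] []"
    and pat: "\<And>xs as i j. Rel xs as \<Longrightarrow> i < length xs \<Longrightarrow> j < length xs \<Longrightarrow> xs ! i = xs ! j \<longleftrightarrow> as ! i = as ! j"
    and len: "\<And>xs as. Rel xs as \<Longrightarrow> length xs = length as"
    and forw: "\<And>xs as x. Rel xs as \<Longrightarrow> \<exists>a. Rel (xs @ [x]) (as @ [a])"
    and backw: "\<And>xs as a. Rel xs as \<Longrightarrow> \<exists>x. Rel (xs @ [x]) (as @ [a])"
  obtains \<pi> where "bij \<pi>" "\<And>X. finite X \<Longrightarrow> \<exists>xs. X \<subseteq> set xs \<and> Rel xs (map \<pi> xs)"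
proof -
  \<comment> \<open>Stage \<open>n\<close> puts \<open>n\<close> into the domain by
    \<open>forw\<close> and then into the range by \<open>backw\<close>, so the union of the finite
    matchings is total on both sides.\<close>
  have "\<exists>f. \<forall>n. Rel (fst (f n)) (snd (f n)) \<and>
      (\<exists>x a. fst (f (Suc n)) = fst (f n) @ [n, x] \<and> snd (f (Suc n)) = snd (f n) @ [a, n])"
  proof (rule dependent_nat_choice)
    show "\<exists>p. Rel (fst p) (snd p)" using base by (intro exI[of _ "([],[])"]) simp
    fix p :: "nat list \<times> nat list" and n :: nat assume "Rel (fst p) (snd p)"
    then obtain a where "Rel (fst p @ [n]) (snd p @ [a])" using forw by blast
    then obtain x where "Rel ((fst p @ [n]) @ [x]) ((snd p @ [a]) @ [n])" using backw by blast
    then show "\<exists>q. Rel (fst q) (snd q) \<and> (\<exists>x a. fst q = fst p @ [n, x] \<and> snd q = snd p @ [a, n])"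
      by (intro exI[of _ "(fst p @ [n, x], snd p @ [a, n])"]) auto
  qed
  then obtain f where R: "\<And>n. Rel (fst (f n)) (snd (f n))"
    and step: "\<And>n. \<exists>x a. fst (f (Suc n)) = fst (f n) @ [n, x] \<and> snd (f (Suc n)) = snd (f n) @ [a, n]"
    by blast
  define z where "z n = set (zip (fst (f n)) (snd (f n)))" for n
  have len': "length (fst (f n)) = length (snd (f n))" for n using len[OF R] .
  have z_Suc: "z n \<subseteq> z (Suc n)" for n
    using step[of n] len'[of n] by (auto simp: z_def)
  have z_mono: "n \<le> m \<Longrightarrow> z n \<subseteq> z m" for n m
    using z_Suc lift_Suc_mono_le by blast
  \<comment> \<open>Two pairs from different stages lie in a common later matching, where
    \<open>pat\<close> yields single-valuedness and injectivity at once.\<close>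
  have z_iff: "x = y \<longleftrightarrow> a = b" if "(x, a) \<in> z n" "(y, b) \<in> z m" for x y a b n m
  proof -
    have "(x, a) \<in> z (max n m)" "(y, b) \<in> z (max n m)"
      using that z_mono[of n "max n m"] z_mono[of m "max n m"] by auto
    then obtain i j where "i < length (fst (f (max n m)))" "j < length (fst (f (max n m)))"
      "x = fst (f (max n m)) ! i" "a = snd (f (max n m)) ! i"
      "y = fst (f (max n m)) ! j" "b = snd (f (max n m)) ! j"
      unfolding z_def in_set_zip by auto
    then show ?thesis using pat[OF R] by metis
  qed
  have z_x: "\<exists>a. (x, a) \<in> z (Suc x)" for x
    using step[of x] len'[of x] by (auto simp: z_def)
  have z_a: "\<exists>x. (x, a) \<in> z (Suc a)" for a
    using step[of a] len'[of a] by (auto simp: z_def)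
  obtain \<pi> where \<pi>: "\<And>x. (x, \<pi> x) \<in> z (Suc x)" using z_x by metis
  have \<pi>_eq: "\<pi> x = a" if "(x, a) \<in> z n" for x a n
    using z_iff[OF that \<pi>[of x]] by blast
  show thesis
  proof
    show "bij \<pi>"
    proof (rule bijI)
      show "inj \<pi>" by (rule injI) (metis z_iff \<pi>)
      show "surj \<pi>" unfolding surj_def using z_a \<pi>_eq by metis
    qed
    fix X :: "nat set" assume "finite X"
    then obtain n where n: "\<forall>x\<in>X. x < n" using finite_nat_set_iff_bounded by blast
    have "X \<subseteq> set (fst (f n))"
    proof
      fix x assume "x \<in> X"
      then have "(x, \<pi> x) \<in> z n" using n z_mono[of "Suc x" n] \<pi>[of x] by (auto simp: Suc_le_eq)
      then show "x \<in> set (fst (f n))" by (auto simp: z_def dest: set_zip_leftD)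
    qed
    moreover have "map \<pi> (fst (f n)) = snd (f n)"
    proof (rule nth_equalityI)
      fix i assume "i < length (map \<pi> (fst (f n)))"
      then have "(fst (f n) ! i, snd (f n) ! i) \<in> z n"
        using len'[of n] by (auto simp: z_def in_set_zip)
      then show "map \<pi> (fst (f n)) ! i = snd (f n) ! i"
        using \<pi>_eq \<open>i < _\<close> by simp
    qed (simp add: len')
    \<comment> \<open>\<open>Rel\<close> is not assumed to pass to subtuples, so only some list
      covering \<open>X\<close> can be offered.\<close>
    ultimately show "\<exists>xs. X \<subseteq> set xs \<and> Rel xs (map \<pi> xs)" using R[of n] by metis
  qed
qed

section \<open>The Borel space of structures\<close>

lemma openin_product_cylinder:
  assumes "openin (product_topology X I) U" "x \<in> U"
  obtains J V where "finite J" "J \<subseteq> I" "\<And>i. i \<in> J \<Longrightarrow> openin (X i) (V i) \<and> x i \<in> V i"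
    "\<And>y. y \<in> topspace (product_topology X I) \<Longrightarrow> (\<And>i. i \<in> J \<Longrightarrow> y i \<in> V i) \<Longrightarrow> y \<in> U"
proof -
  obtain V where V: "finite {i \<in> I. V i \<noteq> topspace (X i)}" "\<forall>i\<in>I. openin (X i) (V i)"
    "x \<in> Pi\<^sub>E I V" "Pi\<^sub>E I V \<subseteq> U"
    using assms unfolding openin_product_topology_alt by blast
  show thesis
  proof (rule that[of "{i \<in> I. V i \<noteq> topspace (X i)}" V])
    fix y assume y: "y \<in> topspace (product_topology X I)"
      and yV: "\<And>i. i \<in> {i \<in> I. V i \<noteq> topspace (X i)} \<Longrightarrow> y i \<in> V i"
    have "y i \<in> V i" if "i \<in> I" for i
      using that y yV[of i] by (cases "V i = topspace (X i)") (auto simp: PiE_iff)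
    with y have "y \<in> Pi\<^sub>E I V" by (simp add: PiE_iff)
    with V(4) show "y \<in> U" by blast
  qed (use V(1,2) PiE_mem[OF V(3)] in blast)+
qed

lemma openin_discrete_cylinder:
  assumes "openin (product_topology (\<lambda>s. product_topology (\<lambda>_. discrete_topology UNIV) (T s)) I) U"
    "x \<in> U"
  obtains A where "finite A" "A \<subseteq> Sigma I T"
    "\<And>y. y \<in> (\<Pi>\<^sub>E s\<in>I. T s \<rightarrow>\<^sub>E UNIV) \<Longrightarrow> (\<And>s t. (s, t) \<in> A \<Longrightarrow> y s t = x s t) \<Longrightarrow> y \<in> U"
proof -
  obtain J V where J: "finite J" "J \<subseteq> I"
    and V: "\<And>s. s \<in> J \<Longrightarrow> openin (product_topology (\<lambda>_. discrete_topology UNIV) (T s)) (V s) \<and> x s \<in> V s"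
    and U: "\<And>y. y \<in> (\<Pi>\<^sub>E s\<in>I. T s \<rightarrow>\<^sub>E UNIV) \<Longrightarrow> (\<And>i. i \<in> J \<Longrightarrow> y i \<in> V i) \<Longrightarrow> y \<in> U"
    using openin_product_cylinder[OF assms] by (auto simp: o_def)
  have "\<exists>B. finite B \<and> B \<subseteq> T s \<and> (\<forall>y. y \<in> (T s \<rightarrow>\<^sub>E UNIV) \<longrightarrow> (\<forall>t\<in>B. y t = x s t) \<longrightarrow> y \<in> V s)"
    if s: "s \<in> J" for s
  proof -
    obtain B W where "finite B" "B \<subseteq> T s" "\<And>i. i \<in> B \<Longrightarrow> x s i \<in> W i"
      "\<And>y. y \<in> topspace (product_topology (\<lambda>_. discrete_topology UNIV) (T s)) \<Longrightarrow> (\<And>i. i \<in> B \<Longrightarrow> y i \<in> W i) \<Longrightarrow> y \<in> V s"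
      by (rule openin_product_cylinder[OF conjunct1[OF V[OF s]] conjunct2[OF V[OF s]]]) blast
    then show ?thesis by (intro exI[of _ B]) auto
  qed
  then obtain B where B: "\<And>s. s \<in> J \<Longrightarrow> finite (B s) \<and> B s \<subseteq> T s \<and>
      (\<forall>y. y \<in> (T s \<rightarrow>\<^sub>E UNIV) \<longrightarrow> (\<forall>t\<in>B s. y t = x s t) \<longrightarrow> y \<in> V s)"
    by metis
  show thesis
  proof (rule that[of "Sigma J B"])
    show "finite (Sigma J B)" using J B by (intro finite_SigmaI) auto
    show "Sigma J B \<subseteq> Sigma I T" using J B by blast
    fix y assume y: "y \<in> (\<Pi>\<^sub>E s\<in>I. T s \<rightarrow>\<^sub>E UNIV)" and eq: "\<And>s t. (s, t) \<in> Sigma J B \<Longrightarrow> y s t = x s t"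
    show "y \<in> U"
    proof (rule U[OF y])
      fix s assume s: "s \<in> J"
      then have "y s \<in> (T s \<rightarrow>\<^sub>E UNIV)" using y J by (auto simp: PiE_iff)
      then show "y s \<in> V s" using B[OF s] eq s by auto
    qed
  qed
qed

lemma openin_Str_cylinder:
  assumes "openin (Str_top L) U" "M \<in> U"
  obtains A B where "finite A" "A \<subseteq> (SIGMA R:Rel L. tuples (rel_ar L R))"
    "finite B" "B \<subseteq> (SIGMA f:Fun L. tuples (fun_ar L f))"
    "\<And>M'. M' \<in> Str L \<Longrightarrow> (\<And>R xs. (R, xs) \<in> A \<Longrightarrow> fst M' R xs = fst M R xs) \<Longrightarrow>
       (\<And>f xs. (f, xs) \<in> B \<Longrightarrow> snd M' f xs = snd M f xs) \<Longrightarrow> M' \<in> U"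
proof -
  obtain V W where
    V: "openin (product_topology
        (\<lambda>R. product_topology (\<lambda>_. discrete_topology UNIV) (tuples (rel_ar L R))) (Rel L)) V" "fst M \<in> V"
    and W: "openin (product_topology
        (\<lambda>f. product_topology (\<lambda>_. discrete_topology UNIV) (tuples (fun_ar L f))) (Fun L)) W" "snd M \<in> W"
    and VW: "V \<times> W \<subseteq> U"
    using assms(1)[unfolded Str_top_def openin_prod_topology_alt, rule_format, of "fst M" "snd M"] assms(2)
    by auto
  obtain A where A: "finite A" "A \<subseteq> (SIGMA R:Rel L. tuples (rel_ar L R))"
    "\<And>y. y \<in> (\<Pi>\<^sub>E R\<in>Rel L. tuples (rel_ar L R) \<rightarrow>\<^sub>E UNIV) \<Longrightarrow>
      (\<And>s t. (s, t) \<in> A \<Longrightarrow> y s t = fst M s t) \<Longrightarrow> y \<in> V"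
    by (rule openin_discrete_cylinder[OF V]) blast
  obtain B where B: "finite B" "B \<subseteq> (SIGMA f:Fun L. tuples (fun_ar L f))"
    "\<And>y. y \<in> (\<Pi>\<^sub>E f\<in>Fun L. tuples (fun_ar L f) \<rightarrow>\<^sub>E UNIV) \<Longrightarrow>
      (\<And>s t. (s, t) \<in> B \<Longrightarrow> y s t = snd M s t) \<Longrightarrow> y \<in> W"
    by (rule openin_discrete_cylinder[OF W]) blast
  show thesis
  proof (rule that[OF A(1,2) B(1,2)])
    fix M' assume M': "M' \<in> Str L" "\<And>R xs. (R, xs) \<in> A \<Longrightarrow> fst M' R xs = fst M R xs"
       "\<And>f xs. (f, xs) \<in> B \<Longrightarrow> snd M' f xs = snd M f xs"
    have "fst M' \<in> (\<Pi>\<^sub>E R\<in>Rel L. tuples (rel_ar L R) \<rightarrow>\<^sub>E UNIV)"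
      "snd M' \<in> (\<Pi>\<^sub>E f\<in>Fun L. tuples (fun_ar L f) \<rightarrow>\<^sub>E UNIV)"
      using M'(1) unfolding Str_def mem_Times_iff by blast+
    then have "fst M' \<in> V" "snd M' \<in> W"
      using A(3) B(3) M'(2,3) by blast+
    then show "M' \<in> U" using VW by (cases M') auto
  qed
qed

lemma openin_Str_rel:
  assumes "R \<in> Rel L" "xs \<in> tuples (rel_ar L R)"
  shows "openin (Str_top L) {M \<in> Str L. fst M R xs}"
proof -
  let ?X = "\<lambda>R. product_topology (\<lambda>_. discrete_topology (UNIV :: bool set)) (tuples (rel_ar L R))"
  have "continuous_map (Str_top L) (product_topology ?X (Rel L)) fst"
    unfolding Str_top_def by (rule continuous_map_fst)
  from continuous_map_compose[OF this continuous_map_product_projection[OF assms(1)]]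
  have "continuous_map (Str_top L) (?X R) (\<lambda>M. fst M R)" by (simp add: o_def)
  from continuous_map_compose[OF this continuous_map_product_projection[OF assms(2)]]
  have "continuous_map (Str_top L) (discrete_topology UNIV) (\<lambda>M. fst M R xs)" by (simp add: o_def)
  from openin_continuous_map_preimage[OF this, of "{True}"] show ?thesis by simp
qed

lemma openin_Str_fun:
  assumes "f \<in> Fun L" "xs \<in> tuples (fun_ar L f)"
  shows "openin (Str_top L) {M \<in> Str L. snd M f xs = y}"
proof -
  let ?X = "\<lambda>f. product_topology (\<lambda>_. discrete_topology (UNIV :: nat set)) (tuples (fun_ar L f))"
  have "continuous_map (Str_top L) (product_topology ?X (Fun L)) snd"
    unfolding Str_top_def by (rule continuous_map_snd)
  from continuous_map_compose[OF this continuous_map_product_projection[OF assms(1)]]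
  have "continuous_map (Str_top L) (?X f) (\<lambda>M. snd M f)" by (simp add: o_def)
  from continuous_map_compose[OF this continuous_map_product_projection[OF assms(2)]]
  have "continuous_map (Str_top L) (discrete_topology UNIV) (\<lambda>M. snd M f xs)" by (simp add: o_def)
  from openin_continuous_map_preimage[OF this, of "{y}"] show ?thesis by simp
qed

lemma sets_Str_open: "openin (Str_top L) U \<Longrightarrow> U \<in> sets (Str_borel L)"
  by (simp add: sets_Str_borel sigma_sets.Basic)

lemmas sets_Str_rel = sets_Str_open[OF openin_Str_rel]
lemmas sets_Str_fun = sets_Str_open[OF openin_Str_fun]

lemma countable_tuple_pairs:
  assumes "countable I" shows "countable (SIGMA s:I. tuples (n s))"
  using assms by (intro countable_SIGMA) auto

text \<open>Over a countable language there are only countably many finite sets of atomic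
  conditions, and an open set is the union of the cylinders they define inside it. Hence atomic
  events suffice, although the Borel sets are generated by all open sets.\<close>

lemma measurable_Str_borelI:
  assumes cL: "countable_language L"
    and \<Phi>: "\<Phi> \<in> space X \<rightarrow> Str L"
    and rel: "\<And>R xs. R \<in> Rel L \<Longrightarrow> xs \<in> tuples (rel_ar L R) \<Longrightarrow> {x \<in> space X. fst (\<Phi> x) R xs} \<in> sets X"
    and func: "\<And>f xs y. f \<in> Fun L \<Longrightarrow> xs \<in> tuples (fun_ar L f) \<Longrightarrow> {x \<in> space X. snd (\<Phi> x) f xs = y} \<in> sets X"
  shows "\<Phi> \<in> X \<rightarrow>\<^sub>M Str_borel L"
  unfolding Str_borel_def
proof (rule measurable_measure_of)
  show "{U. openin (Str_top L) U} \<subseteq> Pow (Str L)"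
    using openin_subset[of "Str_top L"] by auto
  fix U assume "U \<in> {U. openin (Str_top L) U}"
  then have U: "openin (Str_top L) U" by simp
  define DR where "DR = (SIGMA R:Rel L. tuples (rel_ar L R))"
  define DF where "DF = (SIGMA f:Fun L. tuples (fun_ar L f))"
  have cD: "countable DR" "countable DF"
    using cL by (auto simp: DR_def DF_def countable_language_def intro: countable_tuple_pairs)
  define K where "K = {A. finite A \<and> A \<subseteq> DR \<times> (UNIV :: bool set)} \<times> {B. finite B \<and> B \<subseteq> DF \<times> (UNIV :: nat set)}"
  have cK: "countable K"
    unfolding K_def using cD by (intro countable_SIGMA countable_Collect_finite_subset countable_SIGMA) auto
  define cyl where "cyl c M \<longleftrightarrow> (\<forall>p\<in>fst c. fst M (fst (fst p)) (snd (fst p)) = snd p) \<and>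
      (\<forall>p\<in>snd c. snd M (fst (fst p)) (snd (fst p)) = snd p)" for c and M :: "('a, 'b) struct"
  define K' where "K' = {c \<in> K. {M \<in> Str L. cyl c M} \<subseteq> U}"
  have cyl_meas: "{x \<in> space X. cyl c (\<Phi> x)} \<in> sets X" if "c \<in> K" for c
  proof -
    have 1: "{x \<in> space X. \<forall>p\<in>fst c. fst (\<Phi> x) (fst (fst p)) (snd (fst p)) = snd p} \<in> sets X"
    proof (rule sets.sets_Collect_finite_All)
      fix p assume p: "p \<in> fst c"
      then have "{x \<in> space X. fst (\<Phi> x) (fst (fst p)) (snd (fst p))} \<in> sets X"
        using that by (intro rel) (auto simp: K_def DR_def)
      from sets.sets_Collect_neg[OF this] this
      show "{x \<in> space X. fst (\<Phi> x) (fst (fst p)) (snd (fst p)) = snd p} \<in> sets X"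
        by (cases "snd p") auto
    qed (use that in \<open>auto simp: K_def\<close>)
    have 2: "{x \<in> space X. \<forall>p\<in>snd c. snd (\<Phi> x) (fst (fst p)) (snd (fst p)) = snd p} \<in> sets X"
    proof (rule sets.sets_Collect_finite_All)
      fix p assume p: "p \<in> snd c"
      then show "{x \<in> space X. snd (\<Phi> x) (fst (fst p)) (snd (fst p)) = snd p} \<in> sets X"
        using that by (intro func) (auto simp: K_def DF_def)
    qed (use that in \<open>auto simp: K_def\<close>)
    show ?thesis unfolding cyl_def by (rule sets.sets_Collect_conj[OF 2 1])
  qed
  have "\<exists>c\<in>K'. cyl c M" if M: "M \<in> U" for M
  proof -
    obtain A B where AB: "finite A" "A \<subseteq> DR" "finite B" "B \<subseteq> DF"
      "\<And>M'. M' \<in> Str L \<Longrightarrow> (\<And>R xs. (R, xs) \<in> A \<Longrightarrow> fst M' R xs = fst M R xs) \<Longrightarrow>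
       (\<And>f xs. (f, xs) \<in> B \<Longrightarrow> snd M' f xs = snd M f xs) \<Longrightarrow> M' \<in> U"
      unfolding DR_def DF_def using openin_Str_cylinder[OF U M] by metis
    let ?c = "((\<lambda>p. (p, fst M (fst p) (snd p))) ` A, (\<lambda>p. (p, snd M (fst p) (snd p))) ` B)"
    have "?c \<in> K" using AB by (auto simp: K_def)
    moreover have "cyl ?c M" by (auto simp: cyl_def)
    moreover have "M' \<in> U" if "M' \<in> Str L" "cyl ?c M'" for M'
      using that by (intro AB(5)) (auto simp: cyl_def)
    ultimately have "?c \<in> K'" unfolding K'_def by blast
    with \<open>cyl ?c M\<close> show ?thesis by blast
  qed
  then have "M \<in> U \<longleftrightarrow> (\<exists>c\<in>K'. cyl c M)" if "M \<in> Str L" for M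
    using that unfolding K'_def by blast
  then have "\<Phi> -` U \<inter> space X = (\<Union>c\<in>K'. {x \<in> space X. cyl c (\<Phi> x)})"
    using \<Phi> by (intro set_eqI) (simp add: Pi_iff, blast)
  also have "\<dots> \<in> sets X"
    using cyl_meas cK by (intro sets.countable_UN') (auto simp: K'_def)
  finally show "\<Phi> -` U \<inter> space X \<in> sets X" .
qed (use \<Phi> in auto)

lemma Str_eqI:
  assumes M: "M \<in> Str L" and M': "M' \<in> Str L"
    and rel: "\<And>R xs. R \<in> Rel L \<Longrightarrow> xs \<in> tuples (rel_ar L R) \<Longrightarrow> fst M R xs = fst M' R xs"
    and func: "\<And>f xs. f \<in> Fun L \<Longrightarrow> xs \<in> tuples (fun_ar L f) \<Longrightarrow> snd M f xs = snd M' f xs"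
  shows "M = M'"
proof -
  have fst: "fst M \<in> (\<Pi>\<^sub>E R\<in>Rel L. tuples (rel_ar L R) \<rightarrow>\<^sub>E UNIV)"
      "fst M' \<in> (\<Pi>\<^sub>E R\<in>Rel L. tuples (rel_ar L R) \<rightarrow>\<^sub>E UNIV)"
    using M M' unfolding Str_def mem_Times_iff by blast+
  have snd: "snd M \<in> (\<Pi>\<^sub>E f\<in>Fun L. tuples (fun_ar L f) \<rightarrow>\<^sub>E UNIV)"
      "snd M' \<in> (\<Pi>\<^sub>E f\<in>Fun L. tuples (fun_ar L f) \<rightarrow>\<^sub>E UNIV)"
    using M M' unfolding Str_def mem_Times_iff by blast+
  have "fst M = fst M'"
    by (intro PiE_ext[OF fst] PiE_ext[OF PiE_mem[OF fst(1)] PiE_mem[OF fst(2)]] rel)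
  moreover have "snd M = snd M'"
    by (intro PiE_ext[OF snd] PiE_ext[OF PiE_mem[OF snd(1)] PiE_mem[OF snd(2)]] func)
  ultimately show ?thesis by (rule prod_eqI)
qed

section \<open>Isomorphisms and Borel invariant predicates\<close>

lemma is_iso_id: "is_iso L id M M"
  by (simp add: is_iso_def)

lemma is_iso_comp:
  assumes "is_iso L g M N" "is_iso L h N K"
  shows "is_iso L (h \<circ> g) M K"
  using assms by (auto simp: is_iso_def bij_comp)

lemma is_iso_inv:
  assumes "is_iso L g M N"
  shows "is_iso L (inv g) N M"
proof -
  have g: "bij g" using assms by (simp add: is_iso_def)
  then have [simp]: "g (inv g x) = x" "inv g (g x) = x" for x
    by (auto simp: bij_is_surj surj_f_inv_f bij_is_inj inv_f_f)
  have [simp]: "map g (map (inv g) xs) = xs" for xs by (simp add: o_def)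
  show ?thesis unfolding is_iso_def
  proof (intro conjI ballI)
    show "bij (inv g)" using g by (rule bij_imp_bij_inv)
    fix R xs assume "R \<in> Rel L" "xs \<in> tuples (rel_ar L R)"
    then show "fst N R xs \<longleftrightarrow> fst M R (map (inv g) xs)"
      using assms unfolding is_iso_def by (metis \<open>map g (map (inv g) xs) = xs\<close> map_in_tuples)
  next
    fix f xs assume "f \<in> Fun L" "xs \<in> tuples (fun_ar L f)"
    then have "g (snd M f (map (inv g) xs)) = snd N f xs"
      using assms unfolding is_iso_def by (metis \<open>map g (map (inv g) xs) = xs\<close> map_in_tuples)
    then show "inv g (snd N f xs) = snd M f (map (inv g) xs)"
      by (metis \<open>inv g (g (snd M f (map (inv g) xs))) = _\<close>)
  qed
qed

lemma bij_inv_map [simp]: "bij g \<Longrightarrow> map (inv g) (map g xs) = xs"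
  by (simp add: bij_is_inj)

lemma bij_map_inv [simp]: "bij g \<Longrightarrow> map g (map (inv g) xs) = xs"
  by (simp add: surj_iff[THEN iffD1, OF bij_is_surj])

lemma logic_act_rel:
  "R \<in> Rel L \<Longrightarrow> xs \<in> tuples (rel_ar L R) \<Longrightarrow> fst (logic_act L g M) R xs = fst M R (map (inv g) xs)"
  by (simp add: logic_act_def)

lemma logic_act_fun:
  "f \<in> Fun L \<Longrightarrow> xs \<in> tuples (fun_ar L f) \<Longrightarrow> snd (logic_act L g M) f xs = g (snd M f (map (inv g) xs))"
  by (simp add: logic_act_def)

lemma is_iso_logic_act: "bij g \<Longrightarrow> is_iso L g M (logic_act L g M)"
  unfolding is_iso_def by (auto simp: logic_act_rel logic_act_fun simp del: map_map)

lemma logic_act_eq_iff: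
  assumes "N \<in> Str L" "bij g"
  shows "logic_act L g M = N \<longleftrightarrow> is_iso L g M N"
proof
  assume iso: "is_iso L g M N"
  show "logic_act L g M = N"
  proof (rule Str_eqI[OF logic_act_in_Str assms(1)])
    fix R xs assume *: "R \<in> Rel L" "xs \<in> tuples (rel_ar L R)"
    then have "fst M R (map (inv g) xs) = fst N R (map g (map (inv g) xs))"
      using iso unfolding is_iso_def by (metis map_in_tuples)
    then show "fst (logic_act L g M) R xs = fst N R xs"
      using * assms(2) by (simp add: logic_act_rel del: map_map)
  next
    fix f xs assume *: "f \<in> Fun L" "xs \<in> tuples (fun_ar L f)"
    then have "g (snd M f (map (inv g) xs)) = snd N f (map g (map (inv g) xs))"
      using iso unfolding is_iso_def by (metis map_in_tuples)
    then show "snd (logic_act L g M) f xs = snd N f xs"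
      using * assms(2) by (simp add: logic_act_fun del: map_map)
  qed
qed (use is_iso_logic_act[OF assms(2)] in blast)

text \<open>An atomic formula whose variables are positions in a tuple. As \<open>nth\<close> beyond
  the end of a list does not commute with \<open>map g\<close>, a variable out of range makes the
  formula false; this keeps it invariant.\<close>

definition rel_at :: "'r \<Rightarrow> nat list \<Rightarrow> ('r, 'f) struct \<Rightarrow> nat list \<Rightarrow> bool" where
  "rel_at R is M xs \<longleftrightarrow> (\<forall>i\<in>set is. i < length xs) \<and> fst M R (map (nth xs) is)"

definition fun_at :: "'f \<Rightarrow> nat list \<Rightarrow> nat \<Rightarrow> ('r, 'f) struct \<Rightarrow> nat list \<Rightarrow> bool" where
  "fun_at f is j M xs \<longleftrightarrow> (\<forall>i\<in>set is. i < length xs) \<and> j < length xs \<and> snd M f (map (nth xs) is) = xs ! j"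

definition same_atoms ::
    "('r, 'f) language \<Rightarrow> ('r, 'f) struct \<Rightarrow> ('r, 'f) struct \<Rightarrow> nat list \<Rightarrow> nat list \<Rightarrow> bool" where
  "same_atoms L M N xs as \<longleftrightarrow> length xs = length as \<and>
    (\<forall>i j. i < length xs \<and> j < length xs \<longrightarrow> (xs ! i = xs ! j \<longleftrightarrow> as ! i = as ! j)) \<and>
    (\<forall>R\<in>Rel L. \<forall>is\<in>tuples (rel_ar L R). rel_at R is M xs \<longleftrightarrow> rel_at R is N as) \<and>
    (\<forall>f\<in>Fun L. \<forall>is\<in>tuples (fun_ar L f). \<forall>j. fun_at f is j M xs \<longleftrightarrow> fun_at f is j N as)"

lemma map_nth_exists:
  assumes "set xs \<subseteq> set zs"
  obtains "is" where "length is = length xs" "\<forall>i\<in>set is. i < length zs" "map (nth zs) is = xs"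
proof -
  have "\<forall>x\<in>set xs. \<exists>i<length zs. zs ! i = x" using assms by (meson in_set_conv_nth subsetD)
  then obtain p where p: "\<And>x. x \<in> set xs \<Longrightarrow> p x < length zs \<and> zs ! p x = x" by metis
  show thesis by (rule that[of "map p xs"]) (use p in \<open>auto simp: map_idI\<close>)
qed

text \<open>An atomic statement involves finitely many elements and is therefore decided inside one
  covering tuple. For a function symbol that tuple has to contain the value as well as the
  arguments.\<close>

lemma same_atoms_is_iso:
  assumes "bij \<pi>"
    and ex: "\<And>X. finite X \<Longrightarrow> \<exists>xs. X \<subseteq> set xs \<and> same_atoms L M N xs (map \<pi> xs)"
  shows "is_iso L \<pi> M N"
  unfolding is_iso_def
proof (intro conjI ballI)
  fix R xs assume R: "R \<in> Rel L" and xs: "xs \<in> tuples (rel_ar L R)"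
  obtain zs where zs: "set xs \<subseteq> set zs" "same_atoms L M N zs (map \<pi> zs)" using ex[of "set xs"] by auto
  obtain "is" where "is": "length is = length xs" "\<forall>i\<in>set is. i < length zs" "map (nth zs) is = xs"
    using map_nth_exists[OF zs(1)] .
  have "map (nth (map \<pi> zs)) is = map \<pi> (map (nth zs) is)" using "is"(2) by simp
  moreover have "is \<in> tuples (rel_ar L R)" using "is" xs by (simp add: tuples_def)
  then have "rel_at R is M zs \<longleftrightarrow> rel_at R is N (map \<pi> zs)"
    using zs(2) R unfolding same_atoms_def by blast
  ultimately show "fst M R xs \<longleftrightarrow> fst N R (map \<pi> xs)" using "is" by (simp add: rel_at_def del: map_map)
next
  fix f xs assume f: "f \<in> Fun L" and xs: "xs \<in> tuples (fun_ar L f)"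
  let ?y = "snd M f xs"
  obtain zs where zs: "insert ?y (set xs) \<subseteq> set zs" "same_atoms L M N zs (map \<pi> zs)"
    using ex[of "insert ?y (set xs)"] by auto
  obtain "is" where "is": "length is = length xs" "\<forall>i\<in>set is. i < length zs" "map (nth zs) is = xs"
    using map_nth_exists[of xs zs] zs(1) by auto
  obtain j where j: "j < length zs" "zs ! j = ?y" using zs(1) by (auto simp: in_set_conv_nth)
  have "map (nth (map \<pi> zs)) is = map \<pi> (map (nth zs) is)" using "is"(2) by simp
  moreover have "is \<in> tuples (fun_ar L f)" using "is" xs by (simp add: tuples_def)
  then have "fun_at f is j M zs \<longleftrightarrow> fun_at f is j N (map \<pi> zs)"
    using zs(2) f unfolding same_atoms_def by blast
  ultimately show "\<pi> ?y = snd N f (map \<pi> xs)" using "is" j by (simp add: fun_at_def del: map_map)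
qed fact

section \<open>Invariant Borel predicates, types of tuples and the Scott sentence\<close>

definition inv_pred :: "('r, 'f) language \<Rightarrow> (('r, 'f) struct \<Rightarrow> nat list \<Rightarrow> bool) \<Rightarrow> bool" where
  "inv_pred L P \<longleftrightarrow> (\<forall>xs. {M \<in> Str L. P M xs} \<in> sets (Str_borel L)) \<and>
     (\<forall>g\<in>Sym. \<forall>M\<in>Str L. \<forall>xs. P (logic_act L g M) (map g xs) \<longleftrightarrow> P M xs)"

lemma inv_predD: "inv_pred L P \<Longrightarrow> {M \<in> Str L. P M xs} \<in> sets (Str_borel L)"
  by (simp add: inv_pred_def)

lemma inv_pred_act:
  "inv_pred L P \<Longrightarrow> bij g \<Longrightarrow> M \<in> Str L \<Longrightarrow> P (logic_act L g M) (map g xs) \<longleftrightarrow> P M xs"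
  by (simp add: inv_pred_def Sym_def)

lemma inv_pred_iso:
  "inv_pred L P \<Longrightarrow> is_iso L g M N \<Longrightarrow> M \<in> Str L \<Longrightarrow> N \<in> Str L \<Longrightarrow> P N (map g xs) \<longleftrightarrow> P M xs"
  using inv_pred_act logic_act_eq_iff by (metis is_iso_def)

lemma inv_pred_neg: "inv_pred L P \<Longrightarrow> inv_pred L (\<lambda>M xs. \<not> P M xs)"
  unfolding inv_pred_def using sets.sets_Collect_neg[of "Str_borel L"] by auto

lemma inv_pred_const: "inv_pred L (\<lambda>M xs. b)"
  unfolding inv_pred_def using sets.sets_Collect_const[of "Str_borel L"] by auto

lemma inv_pred_All:
  fixes P :: "'i :: countable \<Rightarrow> _"
  assumes "\<And>i. inv_pred L (P i)"
  shows "inv_pred L (\<lambda>M xs. \<forall>i. P i M xs)"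
  using assms sets.sets_Collect_countable_All[of "Str_borel L" "\<lambda>i M. P i M _"]
  unfolding inv_pred_def by simp

lemma inv_pred_All_ext:
  assumes "inv_pred L P"
  shows "inv_pred L (\<lambda>M xs. \<forall>y. P M (xs @ [y]))"
  unfolding inv_pred_def
proof (intro conjI allI ballI)
  fix xs
  show "{M \<in> Str L. \<forall>y. P M (xs @ [y])} \<in> sets (Str_borel L)"
    using sets.sets_Collect_countable_All[of "Str_borel L" "\<lambda>y M. P M (xs @ [y])"] inv_predD[OF assms]
    by simp
next
  fix g M xs assume g: "g \<in> Sym" and M: "M \<in> Str L"
  have bij: "bij g" using g by (simp add: Sym_def)
  have "P (logic_act L g M) (map g xs @ [g y]) = P M (xs @ [y])" for y
    using inv_pred_act[OF assms bij M, of "xs @ [y]"] by simp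
  then show "(\<forall>y. P (logic_act L g M) (map g xs @ [y])) \<longleftrightarrow> (\<forall>y. P M (xs @ [y]))"
    using bij_pointE[OF bij] by metis
qed

lemma inv_pred_Ex_ext:
  assumes "inv_pred L P"
  shows "inv_pred L (\<lambda>M xs. \<exists>y. P M (xs @ [y]))"
  using inv_pred_neg[OF inv_pred_All_ext[OF inv_pred_neg[OF assms]]] by simp

lemma inv_pred_conj_index:
  assumes "\<And>xs. \<forall>i\<in>I. i < length xs \<Longrightarrow> {M \<in> Str L. P M xs} \<in> sets (Str_borel L)"
    and "\<And>g M xs. bij g \<Longrightarrow> \<forall>i\<in>I. i < length xs \<Longrightarrow> P (logic_act L g M) (map g xs) \<longleftrightarrow> P M xs"
  shows "inv_pred L (\<lambda>M xs. (\<forall>i\<in>I. i < length xs) \<and> P M xs)"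
  unfolding inv_pred_def
proof (intro conjI allI ballI)
  fix xs :: "nat list"
  show "{M \<in> Str L. (\<forall>i\<in>I. i < length xs) \<and> P M xs} \<in> sets (Str_borel L)"
  proof (cases "\<forall>i\<in>I. i < length xs")
    case True
    then have "{M \<in> Str L. (\<forall>i\<in>I. i < length xs) \<and> P M xs} = {M \<in> Str L. P M xs}" by blast
    then show ?thesis using assms(1)[OF True] by (simp only:)
  next
    case False
    then have "{M \<in> Str L. (\<forall>i\<in>I. i < length xs) \<and> P M xs} = {}" by blast
    then show ?thesis by (simp only: sets.empty_sets)
  qed
next
  fix g M and xs :: "nat list" assume "g \<in> Sym" "M \<in> Str L"
  then show "((\<forall>i\<in>I. i < length (map g xs)) \<and> P (logic_act L g M) (map g xs)) =
      ((\<forall>i\<in>I. i < length xs) \<and> P M xs)"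
    using assms(2)[of g xs M] unfolding Sym_def length_map by blast
qed

lemma map_nth_map:
  assumes "\<forall>i\<in>set is. i < length xs"
  shows "map (nth (map g xs)) is = map g (map (nth xs) is)"
  using assms by simp

lemma inv_pred_rel_at:
  assumes "R \<in> Rel L" "is \<in> tuples (rel_ar L R)"
  shows "inv_pred L (rel_at R is)"
proof -
  have "inv_pred L (\<lambda>M xs. (\<forall>i\<in>set is. i < length xs) \<and> fst M R (map (nth xs) is))"
  proof (rule inv_pred_conj_index)
    show "{M \<in> Str L. fst M R (map (nth xs) is)} \<in> sets (Str_borel L)" for xs
      by (rule sets_Str_rel) (use assms in \<open>simp_all only: map_in_tuples\<close>)
    fix g :: "nat \<Rightarrow> nat" and M and xs :: "nat list" assume "bij g" "\<forall>i\<in>set is. i < length xs"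
    then show "fst (logic_act L g M) R (map (nth (map g xs)) is) = fst M R (map (nth xs) is)"
      using assms by (simp only: map_nth_map logic_act_rel map_in_tuples bij_inv_map)
  qed
  then show ?thesis by (simp only: rel_at_def[abs_def])
qed

lemma inv_pred_fun_at:
  assumes "f \<in> Fun L" "is \<in> tuples (fun_ar L f)"
  shows "inv_pred L (fun_at f is j)"
proof -
  have "inv_pred L (\<lambda>M xs. (\<forall>i\<in>insert j (set is). i < length xs) \<and> snd M f (map (nth xs) is) = xs ! j)"
  proof (rule inv_pred_conj_index)
    show "{M \<in> Str L. snd M f (map (nth xs) is) = xs ! j} \<in> sets (Str_borel L)" for xs
      by (rule sets_Str_fun) (use assms in \<open>simp_all only: map_in_tuples\<close>)
    fix g :: "nat \<Rightarrow> nat" and M and xs :: "nat list" assume g: "bij g" and i: "\<forall>i\<in>insert j (set is). i < length xs"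
    then have "map g xs ! j = g (xs ! j)" "\<forall>i\<in>set is. i < length xs" by auto
    then show "(snd (logic_act L g M) f (map (nth (map g xs)) is) = map g xs ! j) =
        (snd M f (map (nth xs) is) = xs ! j)"
      using assms g bij_is_inj[OF g, THEN inj_eq]
      by (simp only: map_nth_map logic_act_fun map_in_tuples bij_inv_map)
  qed
  also have "(\<lambda>M xs. (\<forall>i\<in>insert j (set is). i < length xs) \<and> snd M f (map (nth xs) is) = xs ! j) = fun_at f is j"
    by (intro ext) (unfold fun_at_def, blast)
  finally show ?thesis .
qed

text \<open>Invariant Borel predicates are closed under countable conjunctions, negation and quantification over
  elements, so they play the role of the formulas of infinitary logic without any syntax.\<close>

definition indisc :: "('r, 'f) language \<Rightarrow> ('r, 'f) struct \<Rightarrow> nat list \<Rightarrow> nat list \<Rightarrow> bool" where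
  "indisc L N as bs \<longleftrightarrow> (\<forall>P. inv_pred L P \<longrightarrow> (P N as \<longleftrightarrow> P N bs))"

lemma indisc_refl: "indisc L N as as" by (simp add: indisc_def)

lemma indisc_sym: "indisc L N as bs \<Longrightarrow> indisc L N bs as" unfolding indisc_def by blast

lemma indiscD: "indisc L N as bs \<Longrightarrow> inv_pred L P \<Longrightarrow> P N as \<longleftrightarrow> P N bs" by (simp add: indisc_def)

definition separator ::
    "('r, 'f) language \<Rightarrow> ('r, 'f) struct \<Rightarrow> nat list \<Rightarrow> nat list \<Rightarrow> ('r, 'f) struct \<Rightarrow> nat list \<Rightarrow> bool" where
  "separator L N as bs = (SOME P. inv_pred L P \<and> P N as \<and> \<not> P N bs)"

lemma separator:
  assumes "\<not> indisc L N as bs"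
  shows "inv_pred L (separator L N as bs) \<and> separator L N as bs N as \<and> \<not> separator L N as bs N bs"
proof -
  obtain P where P: "inv_pred L P" "P N as \<noteq> P N bs" using assms by (auto simp: indisc_def)
  have "\<exists>P. inv_pred L P \<and> P N as \<and> \<not> P N bs"
  proof (cases "P N as")
    case False
    then show ?thesis using P inv_pred_neg[OF P(1)] by (intro exI[of _ "\<lambda>M xs. \<not> P M xs"]) auto
  qed (use P in blast)
  then show ?thesis unfolding separator_def by (rule someI_ex)
qed

text \<open>There are only countably many lists of naturals, so the conjunction of all separators of
  \<open>as\<close> is again an invariant Borel predicate. It stands for a formula isolating the
  type of \<open>as\<close> in \<open>N\<close>. Where no separator exists, the constant
  \<open>True\<close> keeps each conjunct invariant.\<close>

definition isolates ::
    "('r, 'f) language \<Rightarrow> ('r, 'f) struct \<Rightarrow> nat list \<Rightarrow> ('r, 'f) struct \<Rightarrow> nat list \<Rightarrow> bool" where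
  "isolates L N as M xs \<longleftrightarrow> (\<forall>bs. if indisc L N as bs then True else separator L N as bs M xs)"

lemma inv_pred_isolates: "inv_pred L (isolates L N as)"
proof -
  have "inv_pred L (\<lambda>M xs. if indisc L N as bs then True else separator L N as bs M xs)" for bs
    using separator[of L N as bs] inv_pred_const[of L True] by (cases "indisc L N as bs") auto
  from inv_pred_All[of L "\<lambda>bs M xs. if indisc L N as bs then True else separator L N as bs M xs", OF this]
  show ?thesis by (simp add: isolates_def[abs_def])
qed

lemma isolates_iff: "isolates L N as N bs \<longleftrightarrow> indisc L N as bs"
proof
  assume "isolates L N as N bs"
  then show "indisc L N as bs" unfolding isolates_def using separator[of L N as bs] by metis
next
  have "isolates L N as N as" unfolding isolates_def using separator[of L N as] by auto
  moreover assume "indisc L N as bs"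
  ultimately show "isolates L N as N bs" using indiscD[OF _ inv_pred_isolates] by blast
qed

text \<open>The type of \<open>as @ [c]\<close> is captured by a single predicate, so that it is
  realised over \<open>as\<close> is itself an invariant predicate of \<open>as\<close>, which
  \<open>bs\<close> shares.\<close>

lemma indisc_forth:
  assumes "indisc L N as bs"
  shows "\<exists>d. indisc L N (as @ [c]) (bs @ [d])"
proof -
  have "\<exists>y. isolates L N (as @ [c]) N (as @ [y])"
    using indisc_refl isolates_iff by blast
  then have "\<exists>y. isolates L N (as @ [c]) N (bs @ [y])"
    using indiscD[OF assms inv_pred_Ex_ext[OF inv_pred_isolates]] by blast
  then show ?thesis by (simp add: isolates_iff)
qed

lemma inv_pred_same_atoms:
  assumes "countable_language L"
  shows "inv_pred L (\<lambda>M xs. same_atoms L M N xs as)"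
  unfolding inv_pred_def
proof (intro conjI allI ballI)
  fix xs
  have c: "countable (Rel L)" "countable (Fun L)" using assms by (auto simp: countable_language_def)
  have 1: "{M \<in> Str L. \<forall>R\<in>Rel L. \<forall>is\<in>tuples (rel_ar L R). rel_at R is M xs \<longleftrightarrow> rel_at R is N as} \<in> sets (Str_borel L)"
  proof -
    have *: "{M \<in> space (Str_borel L). rel_at R is M xs \<longleftrightarrow> b} \<in> sets (Str_borel L)"
      if "R \<in> Rel L" "is \<in> tuples (rel_ar L R)" for R "is" b
      using inv_predD[OF inv_pred_rel_at[OF that], of xs] inv_predD[OF inv_pred_neg[OF inv_pred_rel_at[OF that]], of xs]
      by (cases b) auto
    have "{M \<in> space (Str_borel L). \<forall>R\<in>Rel L. \<forall>is\<in>tuples (rel_ar L R). rel_at R is M xs \<longleftrightarrow> rel_at R is N as} \<in> sets (Str_borel L)"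
      using c by (intro sets.sets_Collect_countable_All' *) auto
    then show ?thesis by simp
  qed
  have 2: "{M \<in> Str L. \<forall>f\<in>Fun L. \<forall>is\<in>tuples (fun_ar L f). \<forall>j. fun_at f is j M xs \<longleftrightarrow> fun_at f is j N as} \<in> sets (Str_borel L)"
  proof -
    have *: "{M \<in> space (Str_borel L). fun_at f is j M xs \<longleftrightarrow> b} \<in> sets (Str_borel L)"
      if "f \<in> Fun L" "is \<in> tuples (fun_ar L f)" for f "is" j b
      using inv_predD[OF inv_pred_fun_at[OF that], of j xs] inv_predD[OF inv_pred_neg[OF inv_pred_fun_at[OF that]], of j xs]
      by (cases b) auto
    have "{M \<in> space (Str_borel L). \<forall>f\<in>Fun L. \<forall>is\<in>tuples (fun_ar L f). \<forall>j. fun_at f is j M xs \<longleftrightarrow> fun_at f is j N as} \<in> sets (Str_borel L)"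
      using c by (intro sets.sets_Collect_countable_All' sets.sets_Collect_countable_All *) auto
    then show ?thesis by simp
  qed
  let ?b = "length xs = length as \<and> (\<forall>i j. i < length xs \<and> j < length xs \<longrightarrow> (xs ! i = xs ! j \<longleftrightarrow> as ! i = as ! j))"
  have "{M \<in> Str L. same_atoms L M N xs as} = (if ?b then
      {M \<in> Str L. \<forall>R\<in>Rel L. \<forall>is\<in>tuples (rel_ar L R). rel_at R is M xs \<longleftrightarrow> rel_at R is N as} \<inter>
      {M \<in> Str L. \<forall>f\<in>Fun L. \<forall>is\<in>tuples (fun_ar L f). \<forall>j. fun_at f is j M xs \<longleftrightarrow> fun_at f is j N as} else {})"
    by (auto simp: same_atoms_def)
  then show "{M \<in> Str L. same_atoms L M N xs as} \<in> sets (Str_borel L)"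
    using sets.Int[OF 1 2] sets.empty_sets by (simp only: split: if_split) blast
next
  fix g M xs assume g: "g \<in> Sym" and M: "M \<in> Str L"
  have "rel_at R is (logic_act L g M) (map g xs) = rel_at R is M xs"
    if "R \<in> Rel L" "is \<in> tuples (rel_ar L R)" for R "is"
    using inv_pred_act[OF inv_pred_rel_at[OF that] _ M] g by (simp add: Sym_def)
  moreover have "fun_at f is j (logic_act L g M) (map g xs) = fun_at f is j M xs"
    if "f \<in> Fun L" "is \<in> tuples (fun_ar L f)" for f "is" j
    using inv_pred_act[OF inv_pred_fun_at[OF that] _ M] g by (simp add: Sym_def)
  moreover have "map g xs ! i = map g xs ! j \<longleftrightarrow> xs ! i = xs ! j" if "i < length xs" "j < length xs" for i j
    using g that by (simp add: Sym_def bij_is_inj[THEN inj_eq])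
  ultimately show "same_atoms L (logic_act L g M) N (map g xs) as = same_atoms L M N xs as"
    unfolding same_atoms_def by simp
qed

lemma indisc_same_atoms:
  assumes "countable_language L" "indisc L N as bs"
  shows "same_atoms L N N as bs"
proof -
  have "same_atoms L N N bs bs" by (simp add: same_atoms_def)
  then show ?thesis using indiscD[OF assms(2) inv_pred_same_atoms[OF assms(1)]] by blast
qed

text \<open>Countable structures are homogeneous for these types: \<open>indisc_forth\<close> and
  its mirror image form a back-and-forth system with \<open>as\<close> and \<open>bs\<close> as
  parameters.\<close>

lemma indisc_iff_automorphism:
  assumes L: "countable_language L" and N: "N \<in> Str L"
  shows "indisc L N as bs \<longleftrightarrow> (\<exists>h. is_iso L h N N \<and> map h as = bs)"
proof
  assume ab: "indisc L N as bs"
  have atoms: "same_atoms L N N (as @ xs) (bs @ ys)" if "indisc L N (as @ xs) (bs @ ys)" for xs ys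
    using indisc_same_atoms[OF L that] .
  have len: "length as = length bs" using indisc_same_atoms[OF L ab] by (simp add: same_atoms_def)
  obtain \<pi> where \<pi>: "bij \<pi>" "\<And>X. finite X \<Longrightarrow> \<exists>xs. X \<subseteq> set xs \<and> indisc L N (as @ xs) (bs @ map \<pi> xs)"
  proof (rule back_and_forth[of "\<lambda>xs ys. indisc L N (as @ xs) (bs @ ys)"])
    show "indisc L N (as @ []) (bs @ [])" using ab by simp
  next
    fix xs ys i j assume "indisc L N (as @ xs) (bs @ ys)" "i < length xs" "j < length xs"
    from atoms[OF this(1)] this(2,3) len show "xs ! i = xs ! j \<longleftrightarrow> ys ! i = ys ! j"
      unfolding same_atoms_def
      by (elim conjE allE[of _ "length as + i"] allE[of _ "length as + j"]) (simp add: nth_append)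
  next
    fix xs ys assume "indisc L N (as @ xs) (bs @ ys)"
    from atoms[OF this] len show "length xs = length ys" by (simp add: same_atoms_def)
  next
    fix xs ys x assume "indisc L N (as @ xs) (bs @ ys)"
    from indisc_forth[OF this, of x] show "\<exists>y. indisc L N (as @ xs @ [x]) (bs @ ys @ [y])" by simp
  next
    fix xs ys y assume "indisc L N (as @ xs) (bs @ ys)"
    from indisc_forth[OF indisc_sym[OF this], of y] obtain x
      where "indisc L N ((bs @ ys) @ [y]) ((as @ xs) @ [x])" ..
    from indisc_sym[OF this] show "\<exists>x. indisc L N (as @ xs @ [x]) (bs @ ys @ [y])"
      by (intro exI[of _ x]) simp
  qed blast
  \<comment> \<open>The system only sees the tuples appended to the parameters. Each element of
    \<open>as\<close> therefore has to be met again in a covering tuple, where the equality pattern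
    forces its image.\<close>
  have as: "map \<pi> as = bs"
  proof (rule nth_equalityI)
    fix i assume "i < length (map \<pi> as)"
    then have i: "i < length as" by simp
    obtain xs where xs: "set as \<subseteq> set xs" "indisc L N (as @ xs) (bs @ map \<pi> xs)" using \<pi>(2)[of "set as"] by auto
    then obtain j where j: "j < length xs" "xs ! j = as ! i" using i by (metis in_set_conv_nth nth_mem subsetD)
    from atoms[OF xs(2)] i j len have "bs ! i = \<pi> (xs ! j)"
      unfolding same_atoms_def
      by (elim conjE allE[of _ i] allE[of _ "length as + j"]) (simp add: nth_append)
    then show "map \<pi> as ! i = bs ! i" using i j by simp
  qed (simp add: len)
  have "is_iso L \<pi> N N"
  proof (rule same_atoms_is_iso[OF \<pi>(1)])
    fix X :: "nat set" assume "finite X"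
    then obtain xs where "X \<subseteq> set xs" "indisc L N (as @ xs) (bs @ map \<pi> xs)" using \<pi>(2) by blast
    then show "\<exists>xs. X \<subseteq> set xs \<and> same_atoms L N N xs (map \<pi> xs)"
      using atoms[of xs "map \<pi> xs"] as by (intro exI[of _ "as @ xs"]) (simp add: subset_insertI2 le_supI2)
  qed
  with as show "\<exists>h. is_iso L h N N \<and> map h as = bs" by blast
next
  assume "\<exists>h. is_iso L h N N \<and> map h as = bs"
  then show "indisc L N as bs" unfolding indisc_def using inv_pred_iso[OF _ _ N N] by blast
qed

definition scott ::
    "('r, 'f) language \<Rightarrow> ('r, 'f) struct \<Rightarrow> nat list \<Rightarrow> ('r, 'f) struct \<Rightarrow> nat list \<Rightarrow> bool" where
  "scott L N as M xs \<longleftrightarrow> isolates L N as M xs \<longrightarrow> same_atoms L M N xs as \<and>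
     (\<forall>c. \<exists>y. isolates L N (as @ [c]) M (xs @ [y])) \<and> (\<forall>y. \<exists>c. isolates L N (as @ [c]) M (xs @ [y]))"

text \<open>The conjunction of \<open>isolates L N [] M []\<close> and all instances of \<open>scott\<close> is a Scott sentence of
  \<open>N\<close>: it is Borel, and it makes \<open>isolates\<close> a back-and-forth system between \<open>M\<close> and \<open>N\<close>.\<close>

lemma iso_class_scott:
  assumes L: "countable_language L" and N: "N \<in> Str L"
  shows "iso_class L N = {M \<in> Str L. isolates L N [] M [] \<and> (\<forall>as xs. scott L N as M xs)}"
proof (intro equalityI subsetI)
  fix M assume "M \<in> iso_class L N"
  then obtain g where M: "M \<in> Str L" and g: "is_iso L g M N" by (auto simp: iso_class_def)
  have g': "bij g" using g by (simp add: is_iso_def)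
  \<comment> \<open>Transport along \<open>g\<close> turns a statement about \<open>M\<close> into
    one about orbits in \<open>N\<close>.\<close>
  have iso: "isolates L N as M xs \<longleftrightarrow> indisc L N as (map g xs)" for as xs
    using inv_pred_iso[OF inv_pred_isolates g M N, of N as xs] by (simp add: isolates_iff)
  have "scott L N as M xs" for as xs
    unfolding scott_def
  proof (intro impI conjI allI)
    assume "isolates L N as M xs"
    then have *: "indisc L N as (map g xs)" by (simp add: iso)
    have "same_atoms L N N (map g xs) as" by (rule indisc_same_atoms[OF L indisc_sym[OF *]])
    then show "same_atoms L M N xs as"
      using inv_pred_iso[OF inv_pred_same_atoms[OF L] g M N] by blast
    fix c
    obtain d where "indisc L N (as @ [c]) (map g xs @ [d])" using indisc_forth[OF *] by blast
    moreover obtain y where "d = g y" using bij_pointE[OF g'] by metis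
    ultimately show "\<exists>y. isolates L N (as @ [c]) M (xs @ [y])" by (auto simp: iso)
  next
    fix y
    assume "isolates L N as M xs"
    then have *: "indisc L N as (map g xs)" by (simp add: iso)
    then obtain c where "indisc L N (map g xs @ [g y]) (as @ [c])" using indisc_forth[OF indisc_sym] by blast
    then have "isolates L N (as @ [c]) M (xs @ [y])" using indisc_sym by (simp add: iso)
    then show "\<exists>c. isolates L N (as @ [c]) M (xs @ [y])" ..
  qed
  moreover have "isolates L N [] M []" by (simp add: iso indisc_refl)
  ultimately show "M \<in> {M \<in> Str L. isolates L N [] M [] \<and> (\<forall>as xs. scott L N as M xs)}"
    using M by blast
next
  fix M assume "M \<in> {M \<in> Str L. isolates L N [] M [] \<and> (\<forall>as xs. scott L N as M xs)}"
  then have M: "M \<in> Str L" and base: "isolates L N [] M []" and sc: "\<And>as xs. scott L N as M xs" by blast+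
  have atoms: "same_atoms L M N xs as" if "isolates L N as M xs" for xs as
    using sc that by (simp add: scott_def)
  obtain \<pi> where \<pi>: "bij \<pi>" "\<And>X. finite X \<Longrightarrow> \<exists>xs. X \<subseteq> set xs \<and> isolates L N (map \<pi> xs) M xs"
  proof (rule back_and_forth[of "\<lambda>xs as. isolates L N as M xs"])
    fix xs as i j assume "isolates L N as M xs" "i < length xs" "j < length xs"
    with atoms show "xs ! i = xs ! j \<longleftrightarrow> as ! i = as ! j" by (simp add: same_atoms_def)
  next
    fix xs as assume "isolates L N as M xs"
    with atoms show "length xs = length as" by (simp add: same_atoms_def)
  qed (use base sc in \<open>unfold scott_def, blast+\<close>)
  have "is_iso L \<pi> M N" using same_atoms_is_iso[OF \<pi>(1)] \<pi>(2) atoms by metis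
  then show "M \<in> iso_class L N" using M by (auto simp: iso_class_def)
qed

text \<open>All quantifiers of the Scott sentence range over naturals and lists of naturals, so only
  countable Boolean operations occur.\<close>

lemma iso_class_sets:
  assumes L: "countable_language L" and N: "N \<in> Str L"
  shows "iso_class L N \<in> sets (Str_borel L)"
proof -
  let ?X = "Str_borel L"
  note I = inv_predD[OF inv_pred_isolates]
  have "{M \<in> space ?X. isolates L N [] M [] \<and> (\<forall>as xs. scott L N as M xs)} \<in> sets ?X"
    unfolding scott_def
    by (intro sets.sets_Collect_conj sets.sets_Collect_countable_All sets.sets_Collect_imp
        sets.sets_Collect_countable_Ex)
      (use I inv_predD[OF inv_pred_same_atoms[OF L]] in simp_all)
  then show ?thesis by (simp add: iso_class_scott[OF L N])
qed

section \<open>Algebraicity and the stages of the construction\<close>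

text \<open>It is contained in every finite set that witnesses the failure of high algebraicity, but
  unlike an arbitrary such set it is invariant under automorphisms.\<close>

definition algebraic_part :: "('r, 'f) language \<Rightarrow> ('r, 'f) struct \<Rightarrow> nat set" where
  "algebraic_part L N = (\<Union>as. acl L as N - set as)"

lemma finite_algebraic_part: "\<not> highly_algebraic L N \<Longrightarrow> finite (algebraic_part L N)"
proof -
  assume "\<not> highly_algebraic L N"
  then obtain F where "finite F" "\<And>as. acl L as N \<subseteq> F \<union> set as" by (auto simp: highly_algebraic_def)
  then have "algebraic_part L N \<subseteq> F" by (auto simp: algebraic_part_def)
  then show ?thesis using \<open>finite F\<close> finite_subset by blast
qed

text \<open>Conjugation by \<open>h\<close> carries the stabiliser of \<open>map h as\<close> into
  that of \<open>as\<close>, so the orbit of \<open>h x\<close> lies in the \<open>h\<close>-image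
  of a finite orbit.\<close>

lemma algebraic_part_iso_imp:
  assumes h: "is_iso L h N N" and x: "x \<in> algebraic_part L N"
  shows "h x \<in> algebraic_part L N"
proof -
  obtain as where as: "x \<in> acl L as N" "x \<notin> set as" using x by (auto simp: algebraic_part_def)
  have bij: "bij h" using h by (simp add: is_iso_def)
  then have [simp]: "h (inv h y) = y" "inv h (h y) = y" for y
    by (auto simp: bij_is_surj surj_f_inv_f bij_is_inj inv_f_f)
  have "(\<lambda>g. g (h x)) ` Aut_stab L N (map h as) \<subseteq> h ` (\<lambda>g. g x) ` Aut_stab L N as"
  proof safe
    fix g assume g: "g \<in> Aut_stab L N (map h as)"
    have "inv h \<circ> g \<circ> h \<in> Aut_stab L N as"
      using g is_iso_comp[OF h is_iso_comp[OF _ is_iso_inv[OF h]], of g]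
      by (auto simp: Aut_stab_def o_assoc)
    then have "h ((inv h \<circ> g \<circ> h) x) \<in> h ` (\<lambda>g. g x) ` Aut_stab L N as" by blast
    then show "g (h x) \<in> h ` (\<lambda>g. g x) ` Aut_stab L N as" by simp
  qed
  then have "h x \<in> acl L (map h as) N" using as(1) finite_subset finite_imageI unfolding acl_def mem_Collect_eq by metis
  moreover have "h x \<notin> set (map h as)" using as(2) bij by (auto simp: bij_is_inj[THEN inj_eq])
  ultimately show ?thesis by (auto simp: algebraic_part_def)
qed

lemma algebraic_part_iso:
  assumes h: "is_iso L h N N"
  shows "h x \<in> algebraic_part L N \<longleftrightarrow> x \<in> algebraic_part L N"
proof
  assume "h x \<in> algebraic_part L N"
  then have "inv h (h x) \<in> algebraic_part L N" using algebraic_part_iso_imp[OF is_iso_inv[OF h]] by blast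
  then show "x \<in> algebraic_part L N" using h by (simp add: is_iso_def bij_is_inj inv_f_f)
qed (rule algebraic_part_iso_imp[OF h])

lemma infinite_orbit:
  "x \<notin> algebraic_part L N \<Longrightarrow> x \<notin> set as \<Longrightarrow> infinite ((\<lambda>g. g x) ` Aut_stab L N as)"
  by (auto simp: algebraic_part_def acl_def)

text \<open>The coins of different walks are independent, so any subset of the points of
  \<open>A\<close> may jump simultaneously, and each such pattern must come from an automorphism.
  Disjointness of the image from \<open>A\<close> is what separates two walks whose coins
  differ.\<close>

definition toggles :: "('r, 'f) language \<Rightarrow> ('r, 'f) struct \<Rightarrow> nat set \<Rightarrow> nat set \<Rightarrow> (nat \<Rightarrow> nat) \<Rightarrow> bool" where
  "toggles L N F A s \<longleftrightarrow> inj_on s A \<and> s ` A \<inter> (A \<union> F) = {} \<and>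
     (\<forall>e. (\<forall>a\<in>A. e a \<in> {a, s a}) \<longrightarrow>
        (\<exists>h. is_iso L h N N \<and> (\<forall>x\<in>F. h x = x) \<and> (\<forall>a\<in>A. h a = e a)))"

text \<open>The jump targets are chosen one point at a time. The point \<open>b\<close> has an
  infinite orbit over any finite set avoiding it, so some automorphism moves \<open>b\<close> alone
  to a fresh place; composing it with the automorphisms of the previous step realises all patterns
  on the enlarged set.\<close>

lemma toggles_exist:
  assumes F: "F = algebraic_part L N" "finite F" and A: "finite A" "A \<inter> F = {}"
  shows "\<exists>s. toggles L N F A s"
proof -
  have "\<exists>s. inj_on s B \<and> s ` B \<inter> (A \<union> F) = {} \<and>
     (\<forall>e. (\<forall>a\<in>B. e a \<in> {a, s a}) \<longrightarrow> (\<forall>a\<in>A - B. e a = a) \<longrightarrow>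
        (\<exists>h. is_iso L h N N \<and> (\<forall>x\<in>F. h x = x) \<and> (\<forall>a\<in>A. h a = e a)))"
    if "B \<subseteq> A" for B
    using finite_subset[OF that A(1)] that
  proof (induction B rule: finite_induct)
    case empty
    have "\<exists>h. is_iso L h N N \<and> (\<forall>x\<in>F. h x = x) \<and> (\<forall>a\<in>A. h a = e a)"
      if "\<forall>a\<in>A - {}. e a = a" for e
      using that is_iso_id[of L N] by (intro exI[of _ id]) simp
    then show ?case by simp
  next
    case (insert b B)
    have "B \<subseteq> A" using insert.prems by simp
    from insert.IH[OF this] obtain s where s: "inj_on s B" "s ` B \<inter> (A \<union> F) = {}"
      and e: "\<And>e. (\<forall>a\<in>B. e a \<in> {a, s a}) \<Longrightarrow> (\<forall>a\<in>A - B. e a = a) \<Longrightarrow>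
        \<exists>h. is_iso L h N N \<and> (\<forall>x\<in>F. h x = x) \<and> (\<forall>a\<in>A. h a = e a)"
      by blast
    \<comment> \<open>The earlier targets belong to \<open>Z\<close> because \<open>h0\<close> acts
      after an automorphism that may already have moved points there.\<close>
    define Z where "Z = F \<union> (A - {b}) \<union> s ` B"
    have finZ: "finite Z" using F A insert.hyps by (simp add: Z_def)
    obtain as where as: "set as = Z" using finite_list[OF finZ] by blast
    have b: "b \<in> A" and bB: "b \<notin> B" using insert.prems insert.hyps by simp_all
    then have "b \<notin> Z" using A(2) s(2) by (auto simp: Z_def)
    then have "infinite ((\<lambda>g. g b) ` Aut_stab L N as)"
      using infinite_orbit[of b L N as] as b A(2) F(1) by blast
    then obtain h0 where h0: "h0 \<in> Aut_stab L N as" "h0 b \<notin> insert b Z"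
      using finZ by (meson finite_insert finite_subset image_subsetI)
    have h0': "is_iso L h0 N N" "\<And>z. z \<in> Z \<Longrightarrow> h0 z = z" using h0(1) as by (auto simp: Aut_stab_def)
    let ?s = "s(b := h0 b)"
    show ?case
    proof (rule exI[of _ ?s], intro conjI allI impI)
      show "inj_on ?s (insert b B)"
        using inj_on_fun_updI[OF s(1), of "h0 b" b] h0(2) bB by (simp add: Z_def image_iff)
      show "?s ` insert b B \<inter> (A \<union> F) = {}"
        using s(2) h0(2) bB unfolding Z_def fun_upd_image by auto
      fix e assume e1: "\<forall>a\<in>insert b B. e a \<in> {a, ?s a}" and e2: "\<forall>a\<in>A - insert b B. e a = a"
      \<comment> \<open>The induction hypothesis performs the jumps of \<open>B\<close> with
        \<open>b\<close> at rest; if \<open>b\<close> is to jump, \<open>h0\<close> is applied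
        afterwards.\<close>
      let ?e = "e(b := b)"
      obtain h where h: "is_iso L h N N" "\<forall>x\<in>F. h x = x" "\<forall>a\<in>A. h a = ?e a"
      proof -
        have "\<forall>a\<in>B. ?e a \<in> {a, s a}" using e1 bB by auto
        moreover have "\<forall>a\<in>A - B. ?e a = a" using e2 by auto
        ultimately show thesis using e[of ?e] that by blast
      qed
      show "\<exists>h. is_iso L h N N \<and> (\<forall>x\<in>F. h x = x) \<and> (\<forall>a\<in>A. h a = e a)"
      proof (cases "e b = b")
        case True
        then show ?thesis using h by (intro exI[of _ h]) auto
      next
        case False
        then have eb: "e b = h0 b" using e1 by auto
        show ?thesis
        proof (intro exI[of _ "h0 \<circ> h"] conjI ballI)
          show "is_iso L (h0 \<circ> h) N N" by (rule is_iso_comp[OF h(1) h0'(1)])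
          show "(h0 \<circ> h) x = x" if "x \<in> F" for x using that h(2) h0'(2)[of x] by (auto simp: Z_def)
          fix a assume a: "a \<in> A"
          show "(h0 \<circ> h) a = e a"
          proof (cases "a = b")
            case True
            then show ?thesis using h(3) b eb by simp
          next
            case False
            have "e a = a \<or> e a \<in> s ` B"
              using a False e1[rule_format, of a] e2[rule_format, of a] by (cases "a \<in> B") auto
            then have "e a \<in> Z" using a False by (auto simp: Z_def)
            then show ?thesis using h(3) a False h0'(2) by simp
          qed
        qed
      qed
    qed
  qed
  from this[of A] show ?thesis unfolding toggles_def by auto
qed

section \<open>Back-and-forth demands and the sequence of stages\<close>

definition conjugate :: "('r, 'f) language \<Rightarrow> ('r, 'f) struct \<Rightarrow> nat list \<Rightarrow> nat list \<Rightarrow> bool" where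
  "conjugate L N xs ys \<longleftrightarrow> (\<exists>h. is_iso L h N N \<and> map h xs = ys)"

lemma conjugate_trans: "conjugate L N xs ys \<Longrightarrow> conjugate L N ys zs \<Longrightarrow> conjugate L N xs zs"
  unfolding conjugate_def using is_iso_comp by (metis map_map)

lemma conjugate_sym: "conjugate L N xs ys \<Longrightarrow> conjugate L N ys xs"
  unfolding conjugate_def using is_iso_inv bij_inv_map by (metis is_iso_def)

text \<open>The bound \<open>k\<close> leaves finitely many demands per stage over a finite
  \<open>T\<close>, and every demand falls under the bound from some stage on. Elements of
  \<open>F\<close> are excluded because walks avoid \<open>F\<close>; the marked positions take care
  of them.\<close>

definition witnesses ::
    "('r, 'f) language \<Rightarrow> ('r, 'f) struct \<Rightarrow> nat set \<Rightarrow> nat \<Rightarrow> nat set \<Rightarrow> nat set \<Rightarrow> bool" where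
  "witnesses L N F k T W \<longleftrightarrow> (\<forall>ts as b. set ts \<subseteq> T \<longrightarrow> length ts \<le> k \<longrightarrow> set as \<subseteq> {..k} \<longrightarrow> b \<le> k \<longrightarrow>
     b \<notin> F \<longrightarrow> conjugate L N ts as \<longrightarrow> (\<exists>w\<in>W. conjugate L N (ts @ [w]) (as @ [b])))"

lemma witnessesD:
  assumes "witnesses L N F k T W" "set ts \<subseteq> T" "length ts \<le> k" "set as \<subseteq> {..k}" "b \<le> k" "b \<notin> F"
    "conjugate L N ts as"
  shows "\<exists>w\<in>W. conjugate L N (ts @ [w]) (as @ [b])"
  using assms unfolding witnesses_def by blast

lemma witnesses_mono: "witnesses L N F k T W \<Longrightarrow> W \<subseteq> W' \<Longrightarrow> witnesses L N F k T W'"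
  unfolding witnesses_def subset_eq Bex_def by (intro allI impI) meson

text \<open>The automorphism taking \<open>ts\<close> to \<open>as\<close> is used to pull
  \<open>b\<close> back; the result stays outside \<open>F\<close> because \<open>F\<close> is
  invariant.\<close>

lemma witnesses_exist:
  assumes F: "F = algebraic_part L N" and T: "finite T"
  shows "\<exists>W. finite W \<and> W \<inter> F = {} \<and> witnesses L N F k T W"
proof -
  define P where "P = {(ts, as, b). (set ts \<subseteq> T \<and> length ts \<le> k) \<and> (set as \<subseteq> {..k} \<and> length as \<le> k) \<and>
      b \<le> k \<and> b \<notin> F \<and> conjugate L N ts as}"
  have "P \<subseteq> {ts. set ts \<subseteq> T \<and> length ts \<le> k} \<times> {as. set as \<subseteq> {..k} \<and> length as \<le> k} \<times> {..k}"
    by (auto simp: P_def)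
  then have finP: "finite P"
    by (rule finite_subset) (intro finite_cartesian_product finite_lists_length_le T finite_atMost)
  have "\<exists>w. w \<notin> F \<and> conjugate L N (fst p @ [w]) (fst (snd p) @ [snd (snd p)])" if "p \<in> P" for p
  proof -
    obtain ts as b where p: "p = (ts, as, b)" by (cases p)
    then obtain h where h: "is_iso L h N N" "map h ts = as" and b: "b \<notin> F"
      using \<open>p \<in> P\<close> by (auto simp: P_def conjugate_def)
    have "h (inv h b) = b" using h(1) by (simp add: is_iso_def bij_is_surj surj_f_inv_f)
    moreover from this have "inv h b \<notin> F" using b algebraic_part_iso[OF h(1)] F by metis
    ultimately show ?thesis
      using h p by (intro exI[of _ "inv h b"]) (auto simp: conjugate_def)
  qed
  then obtain w where w: "\<And>p. p \<in> P \<Longrightarrow> w p \<notin> F \<and> conjugate L N (fst p @ [w p]) (fst (snd p) @ [snd (snd p)])"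
    by metis
  have "witnesses L N F k T (w ` P)"
    unfolding witnesses_def
  proof (intro allI impI)
    fix ts as b assume *: "set ts \<subseteq> T" "length ts \<le> k" "set as \<subseteq> {..k}" "b \<le> k" "b \<notin> F" "conjugate L N ts as"
    then have "length as = length ts" by (auto simp: conjugate_def)
    then have "(ts, as, b) \<in> P" using * by (simp add: P_def)
    from w[OF this] imageI[OF this, of w] show "\<exists>w\<in>w ` P. conjugate L N (ts @ [w]) (as @ [b])"
      by (intro bexI[of _ "w (ts, as, b)"]) auto
  qed
  moreover have "w ` P \<inter> F = {}" using w by blast
  ultimately show ?thesis using finP by blast
qed

text \<open>The set \<open>A k\<close> contains the values of all walks at stage \<open>k\<close>.
  The set over which witnesses are demanded contains each value at stage \<open>Suc k\<close> of a
  walk that has started by stage \<open>k\<close>; the witnesses lie in \<open>A (Suc k)\<close>,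
  where a new walk can start.\<close>

locale staged =
  fixes L :: "('r, 'f) language" and N :: "('r, 'f) struct" and fs :: "nat list"
    and A :: "nat \<Rightarrow> nat set" and s :: "nat \<Rightarrow> nat \<Rightarrow> nat"
  assumes countable_L: "countable_language L" and N: "N \<in> Str L"
    and fs: "set fs = algebraic_part L N" "distinct fs"
    and A_nonempty: "A 0 \<noteq> {}"
    and A_disj: "A k \<inter> set fs = {}"
    and A_toggles: "toggles L N (set fs) (A k) (s k)"
    and A_Suc: "A k \<subseteq> A (Suc k)"
    and s_Suc: "s k ` A k \<subseteq> A (Suc k)"
    and A_witnesses: "witnesses L N (set fs) k (set fs \<union> A k \<union> s k ` A k) (A (Suc k))"

text \<open>Dependent choice, beginning with a single point outside \<open>F\<close>: the next stage
  collects the old points, their jump targets and finitely many witnesses. It stays finite, as the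
  choice of new jumps requires.\<close>

lemma staged_exists:
  assumes L: "countable_language L" and N: "N \<in> Str L" and na: "\<not> highly_algebraic L N"
  shows "\<exists>fs A s. staged L N fs A s"
proof -
  have finF: "finite (algebraic_part L N)" using na by (rule finite_algebraic_part)
  then obtain fs where fs: "set fs = algebraic_part L N" "distinct fs"
    using finite_distinct_list by blast
  define P where "P p \<longleftrightarrow> finite (fst p) \<and> fst p \<noteq> {} \<and> fst p \<inter> set fs = {} \<and> toggles L N (set fs) (fst p) (snd p)" for p
  define Q where "Q k p q \<longleftrightarrow> fst p \<subseteq> fst q \<and> snd p ` fst p \<subseteq> fst q \<and>
      witnesses L N (set fs) k (set fs \<union> fst p \<union> snd p ` fst p) (fst q)" for k :: nat and p q :: "nat set \<times> (nat \<Rightarrow> nat)"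
  have ex: "\<exists>s. toggles L N (set fs) B s" if "finite B" "B \<inter> set fs = {}" for B
    using toggles_exist[OF fs(1) _ that] by simp
  have "\<exists>f. \<forall>k. P (f k) \<and> Q k (f k) (f (Suc k))"
  proof (rule dependent_nat_choice)
    obtain a where a: "a \<notin> set fs" using ex_new_if_finite[OF infinite_UNIV_nat, of "set fs"] by auto
    then obtain s0 where "toggles L N (set fs) {a} s0" using ex[of "{a}"] by auto
    with a show "\<exists>p. P p" by (intro exI[of _ "({a}, s0)"]) (simp add: P_def)
  next
    fix p :: "nat set \<times> (nat \<Rightarrow> nat)" and k assume p: "P p"
    obtain W where W: "finite W" "W \<inter> set fs = {}"
        "witnesses L N (set fs) k (set fs \<union> fst p \<union> snd p ` fst p) W"
      using witnesses_exist[OF fs(1), of "set fs \<union> fst p \<union> snd p ` fst p" k] p by (auto simp: P_def)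
    define B where "B = fst p \<union> snd p ` fst p \<union> W"
    have "finite B" "B \<inter> set fs = {}" using p W by (auto simp: B_def P_def toggles_def)
    then obtain s1 where s1: "toggles L N (set fs) B s1" using ex by blast
    have "P (B, s1)" using s1 \<open>finite B\<close> \<open>B \<inter> set fs = {}\<close> p by (auto simp: P_def B_def)
    moreover have "Q k p (B, s1)"
      unfolding Q_def fst_conv
    proof (intro conjI)
      show "fst p \<subseteq> B" "snd p ` fst p \<subseteq> B" unfolding B_def by blast+
      have "W \<subseteq> B" unfolding B_def by blast
      then show "witnesses L N (set fs) k (set fs \<union> fst p \<union> snd p ` fst p) B"
        by (rule witnesses_mono[OF W(3)])
    qed
    ultimately show "\<exists>q. P q \<and> Q k p q" by blast
  qed
  then obtain f where f: "\<And>k. P (f k)" "\<And>k. Q k (f k) (f (Suc k))" by blast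
  have "staged L N fs (\<lambda>k. fst (f k)) (\<lambda>k. snd (f k))"
    by unfold_locales (use L N fs f in \<open>simp_all only: P_def Q_def not_False_eq_True\<close>)
  then show ?thesis by blast
qed

section \<open>The random walks and their limit\<close>

text \<open>A sequence \<open>\<sigma>\<close> of naturals drives one walk: \<open>\<sigma> 0\<close> encodes the stage at which it starts and the
  point at which it starts, and the parity of \<open>\<sigma> (k + 1)\<close> is the coin tossed at stage \<open>k\<close>.\<close>

definition start :: "(nat \<Rightarrow> nat) \<Rightarrow> nat" where "start \<sigma> = fst (prod_decode (\<sigma> 0))"
definition born :: "(nat \<Rightarrow> nat) \<Rightarrow> nat" where "born \<sigma> = snd (prod_decode (\<sigma> 0))"
definition coin :: "(nat \<Rightarrow> nat) \<Rightarrow> nat \<Rightarrow> bool" where "coin \<sigma> k = odd (\<sigma> (Suc k))"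

text \<open>All that the limit needs from randomness. Differing coins at arbitrarily late stages
  separate two walks after both have started; infinitely many positions for each label provide a
  walk with prescribed start outside any given finite set of positions.\<close>

definition generic :: "(nat \<Rightarrow> nat \<Rightarrow> nat) \<Rightarrow> bool" where
  "generic \<omega> \<longleftrightarrow> (\<forall>i j. i \<noteq> j \<longrightarrow> (\<forall>n. \<exists>k\<ge>n. coin (\<omega> i) k \<noteq> coin (\<omega> j) k)) \<and>
     (\<forall>m. infinite {j. \<omega> j 0 = m})"

context staged
begin

text \<open>The values before stage \<open>start \<sigma>\<close>, and all values if the starting point is not in the current stage, are
  irrelevant.  They only have to lie in \<open>A k\<close>.\<close>

primrec walk :: "(nat \<Rightarrow> nat) \<Rightarrow> nat \<Rightarrow> nat" where
  "walk \<sigma> 0 = (if start \<sigma> = 0 \<and> born \<sigma> \<in> A 0 then born \<sigma> else (SOME a. a \<in> A 0))"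
| "walk \<sigma> (Suc k) = (if start \<sigma> = Suc k \<and> born \<sigma> \<in> A (Suc k) then born \<sigma>
     else if coin \<sigma> k then s k (walk \<sigma> k) else walk \<sigma> k)"

lemma walk_in: "walk \<sigma> k \<in> A k"
proof (induction k)
  case 0
  then show ?case using A_nonempty by (auto intro: someI_ex)
next
  case (Suc k)
  then show ?case using A_Suc[of k] s_Suc[of k] by auto
qed

lemma walk_start: "start \<sigma> = k \<Longrightarrow> born \<sigma> \<in> A k \<Longrightarrow> walk \<sigma> k = born \<sigma>"
  by (cases k) auto

lemma walk_step: "start \<sigma> \<le> k \<Longrightarrow> walk \<sigma> (Suc k) = (if coin \<sigma> k then s k (walk \<sigma> k) else walk \<sigma> k)"
  by simp

definition val :: "nat list \<Rightarrow> (nat \<Rightarrow> nat \<Rightarrow> nat) \<Rightarrow> nat \<Rightarrow> nat \<Rightarrow> nat" where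
  "val ps \<omega> k i = (case map_of (zip ps fs) i of Some f \<Rightarrow> f | None \<Rightarrow> walk (\<omega> i) k)"

definition marking :: "nat list \<Rightarrow> bool" where
  "marking ps \<longleftrightarrow> distinct ps \<and> length ps = length fs"

lemma val_marked: "marking ps \<Longrightarrow> m < length fs \<Longrightarrow> val ps \<omega> k (ps ! m) = fs ! m"
  using map_of_zip_nth[of ps fs m] by (simp add: val_def marking_def)

lemma map_val_marking: "marking ps \<Longrightarrow> map (val ps \<omega> k) ps = fs"
  by (rule nth_equalityI) (simp_all add: val_marked, simp_all add: val_marked marking_def)

lemma val_unmarked: "marking ps \<Longrightarrow> i \<notin> set ps \<Longrightarrow> val ps \<omega> k i = walk (\<omega> i) k"
proof -
  assume "marking ps" "i \<notin> set ps"
  then have "map_of (zip ps fs) i = None" by (simp add: map_of_zip_is_None marking_def)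
  then show ?thesis by (simp add: val_def)
qed

lemma val_in_fs: "marking ps \<Longrightarrow> i \<in> set ps \<Longrightarrow> val ps \<omega> k i \<in> set fs"
  by (metis in_set_conv_nth marking_def nth_mem val_marked)

lemma val_in_A: "marking ps \<Longrightarrow> i \<notin> set ps \<Longrightarrow> val ps \<omega> k i \<in> A k"
  by (simp add: val_unmarked walk_in)

text \<open>From such a stage on, one automorphism per step moves all values at once. Two walks at
  the same point could toss different coins, which no automorphism can imitate, and a walk that has
  yet to start will be reset to an unrelated point.\<close>

definition settled :: "nat list \<Rightarrow> (nat \<Rightarrow> nat \<Rightarrow> nat) \<Rightarrow> nat set \<Rightarrow> nat \<Rightarrow> bool" where
  "settled ps \<omega> X k \<longleftrightarrow> inj_on (val ps \<omega> k) X \<and> (\<forall>i\<in>X - set ps. start (\<omega> i) \<le> k)"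

lemma settled_step:
  assumes ps: "marking ps" and X: "settled ps \<omega> X k"
  shows "\<exists>h. is_iso L h N N \<and> (\<forall>i\<in>X. h (val ps \<omega> k i) = val ps \<omega> (Suc k) i)"
proof -
  \<comment> \<open>Coins belong to positions but an automorphism acts on points; injectivity on
    \<open>X\<close> assigns to each occupied point the coin of the only walk there.\<close>
  define e where "e a = (if \<exists>i\<in>X - set ps. val ps \<omega> k i = a \<and> coin (\<omega> i) k then s k a else a)" for a
  have "\<forall>a\<in>A k. e a \<in> {a, s k a}" by (simp add: e_def)
  then obtain h where h: "is_iso L h N N" "\<forall>x\<in>set fs. h x = x" "\<forall>a\<in>A k. h a = e a"
    using A_toggles[of k] unfolding toggles_def by blast
  have "h (val ps \<omega> k i) = val ps \<omega> (Suc k) i" if i: "i \<in> X" for i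
  proof (cases "i \<in> set ps")
    case True
    then obtain m where "m < length fs" "i = ps ! m" using ps by (auto simp: marking_def in_set_conv_nth)
    then show ?thesis using val_marked[OF ps] h(2) by simp
  next
    case False
    have "(\<exists>j\<in>X - set ps. val ps \<omega> k j = val ps \<omega> k i \<and> coin (\<omega> j) k) \<longleftrightarrow> coin (\<omega> i) k"
      using X i False unfolding settled_def by (metis Diff_iff inj_onD)
    then have "h (val ps \<omega> k i) = (if coin (\<omega> i) k then s k (val ps \<omega> k i) else val ps \<omega> k i)"
      using h(3) val_in_A[OF ps False] by (simp add: e_def)
    also have "\<dots> = val ps \<omega> (Suc k) i"
      using X i False walk_step[of "\<omega> i" k] by (simp add: settled_def val_unmarked[OF ps])
    finally show ?thesis .
  qed
  with h(1) show ?thesis by blast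
qed

text \<open>Automorphisms are injective, so a settled set remains settled and the single steps
  compose.\<close>

lemma settled_mono:
  assumes ps: "marking ps" and X: "settled ps \<omega> X n" and "n \<le> k"
  shows "settled ps \<omega> X k \<and> (\<exists>h. is_iso L h N N \<and> (\<forall>i\<in>X. h (val ps \<omega> n i) = val ps \<omega> k i))"
  using \<open>n \<le> k\<close>
proof (induction k rule: dec_induct)
  case base
  show ?case using X is_iso_id[of L N, unfolded id_def] by (intro conjI exI[of _ "\<lambda>x. x"]) simp_all
next
  case (step k)
  then obtain h where h: "is_iso L h N N" "\<forall>i\<in>X. h (val ps \<omega> n i) = val ps \<omega> k i"
    and Xk: "settled ps \<omega> X k" by blast
  obtain h' where h': "is_iso L h' N N" "\<forall>i\<in>X. h' (val ps \<omega> k i) = val ps \<omega> (Suc k) i"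
    using settled_step[OF ps Xk] by blast
  have "inj h'" using h'(1) by (simp add: is_iso_def bij_is_inj)
  then have "inj_on (val ps \<omega> (Suc k)) X"
  proof (intro inj_onI)
    fix i j assume ij: "i \<in> X" "j \<in> X" "val ps \<omega> (Suc k) i = val ps \<omega> (Suc k) j"
    then have "h' (val ps \<omega> k i) = h' (val ps \<omega> k j)" using h'(2) by simp
    then have "val ps \<omega> k i = val ps \<omega> k j" using \<open>inj h'\<close> by (rule injD[rotated])
    then show "i = j" using Xk ij(1,2) unfolding settled_def inj_on_def by blast
  qed
  moreover have "\<forall>i\<in>X - set ps. start (\<omega> i) \<le> Suc k"
  proof
    fix i assume "i \<in> X - set ps"
    then have "start (\<omega> i) \<le> k" using Xk unfolding settled_def by blast
    then show "start (\<omega> i) \<le> Suc k" by (rule le_SucI)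
  qed
  ultimately have "settled ps \<omega> X (Suc k)" unfolding settled_def by blast
  moreover have "is_iso L (h' \<circ> h) N N" by (rule is_iso_comp[OF h(1) h'(1)])
  moreover have "\<forall>i\<in>X. (h' \<circ> h) (val ps \<omega> n i) = val ps \<omega> (Suc k) i" using h(2) h'(2) by simp
  ultimately show ?case by blast
qed

lemma settled_conjugate:
  assumes "marking ps" "settled ps \<omega> X n" "n \<le> k" "set xs \<subseteq> X"
  shows "conjugate L N (map (val ps \<omega> n) xs) (map (val ps \<omega> k) xs)"
proof -
  obtain h where "is_iso L h N N" "\<forall>i\<in>X. h (val ps \<omega> n i) = val ps \<omega> k i"
    using settled_mono[OF assms(1-3)] by blast
  then show ?thesis using assms(4) unfolding conjugate_def by (intro exI[of _ h]) auto
qed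

text \<open>After both walks have started there is a stage with different coins: one walk leaves
  \<open>A k\<close> and the other remains in it. The pair is then settled, hence separated forever.
  Marked positions have values in \<open>F\<close>, which no walk meets.\<close>

lemma eventually_distinct:
  assumes ps: "marking ps" and gen: "generic \<omega>" and ij: "i \<noteq> j"
  shows "\<forall>\<^sub>F k in sequentially. val ps \<omega> k i \<noteq> val ps \<omega> k j"
proof -
  have marked: "\<forall>\<^sub>F k in sequentially. val ps \<omega> k i \<noteq> val ps \<omega> k j"
    if i: "i \<in> set ps" and ij: "i \<noteq> j" for i j
  proof (cases "j \<in> set ps")
    case True
    then obtain m n where "m < length fs" "i = ps ! m" "n < length fs" "j = ps ! n"
      using ps i by (metis in_set_conv_nth marking_def)
    moreover from this have "m \<noteq> n" using ij by blast
    ultimately have "val ps \<omega> k i \<noteq> val ps \<omega> k j" for k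
      using fs(2) by (simp add: val_marked[OF ps] nth_eq_iff_index_eq)
    then show ?thesis by simp
  next
    case False
    then have "val ps \<omega> k i \<noteq> val ps \<omega> k j" for k
      using val_in_fs[OF ps i, of \<omega> k] val_in_A[OF ps False, of \<omega> k] A_disj[of k] by auto
    then show ?thesis by simp
  qed
  consider "i \<in> set ps" | "j \<in> set ps" | "i \<notin> set ps" "j \<notin> set ps" by blast
  then show ?thesis
  proof cases
    case 1
    then show ?thesis by (rule marked) fact
  next
    case 2
    from marked[OF this ij[symmetric]] show ?thesis by (simp add: eq_commute)
  next
    case 3
    obtain k where k: "k \<ge> max (start (\<omega> i)) (start (\<omega> j))" "coin (\<omega> i) k \<noteq> coin (\<omega> j) k"
      using gen ij unfolding generic_def by blast
    have val: "val ps \<omega> n i = walk (\<omega> i) n" "val ps \<omega> n j = walk (\<omega> j) n" for n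
      using 3 by (simp_all add: val_unmarked[OF ps])
    have s: "inj_on (s k) (A k)" "s k ` A k \<inter> A k = {}" using A_toggles[of k] by (auto simp: toggles_def)
    have "walk (\<omega> i) (Suc k) \<noteq> walk (\<omega> j) (Suc k)"
      using k walk_step[of "\<omega> i" k] walk_step[of "\<omega> j" k] s walk_in[of "\<omega> i" k] walk_in[of "\<omega> j" k]
      by (auto simp del: walk.simps)
    then have "inj_on (val ps \<omega> (Suc k)) {i, j}" unfolding inj_on_def val(1)[symmetric] val(2)[symmetric] by auto
    then have "settled ps \<omega> {i, j} (Suc k)" using k(1) unfolding settled_def by auto
    from settled_mono[OF ps this] have "\<forall>n\<ge>Suc k. settled ps \<omega> {i, j} n" by blast
    then have "\<forall>n\<ge>Suc k. val ps \<omega> n i \<noteq> val ps \<omega> n j" using ij unfolding settled_def inj_on_def by blast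
    then show ?thesis unfolding eventually_sequentially by blast
  qed
qed

lemma eventually_settled:
  assumes ps: "marking ps" and gen: "generic \<omega>" and X: "finite X"
  shows "\<forall>\<^sub>F k in sequentially. settled ps \<omega> X k"
proof -
  have "\<forall>\<^sub>F k in sequentially. \<forall>i\<in>X. \<forall>j\<in>X. i \<noteq> j \<longrightarrow> val ps \<omega> k i \<noteq> val ps \<omega> k j"
    using eventually_distinct[OF ps gen]
    by (intro eventually_ball_finite X ballI) (simp add: eventually_mono)
  moreover have "\<forall>\<^sub>F k in sequentially. \<forall>i\<in>X. start (\<omega> i) \<le> k"
    by (intro eventually_ball_finite X ballI eventually_ge_at_top)
  ultimately show ?thesis
    by eventually_elim (auto simp: settled_def inj_on_def)
qed

text \<open>Back-and-forth between positions and elements of \<open>N\<close>. A new position costs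
  nothing, since the orbit of a settled tuple no longer changes; for a new element, a walk has to be
  found that started at a suitable witness.\<close>

lemma limit_exists:
  assumes ps: "marking ps" and gen: "generic \<omega>"
  obtains \<pi> where "bij \<pi>" "map \<pi> ps = fs"
    "\<And>xs. \<forall>\<^sub>F k in sequentially. conjugate L N (map (val ps \<omega> k) xs) (map \<pi> xs)"
proof -
  let ?v = "val ps \<omega>"
  \<comment> \<open>Putting the marked positions and \<open>fs\<close> in front forces the matching
    automorphisms to fix \<open>F\<close> pointwise.\<close>
  define Rel where "Rel xs as \<longleftrightarrow> (\<forall>\<^sub>F k in sequentially. conjugate L N (map (?v k) (ps @ xs)) (fs @ as))" for xs as
  note mv = map_val_marking[OF ps]
  have RelD: "length xs = length as" if R: "Rel xs as" for xs as
  proof -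
    obtain k where "conjugate L N (map (?v k) (ps @ xs)) (fs @ as)"
      using R unfolding Rel_def eventually_sequentially by blast
    then have "length (map (?v k) (ps @ xs)) = length (fs @ as)"
      unfolding conjugate_def by (metis length_map)
    then show ?thesis using ps by (simp add: marking_def)
  qed
  obtain \<pi> where \<pi>: "bij \<pi>" "\<And>X. finite X \<Longrightarrow> \<exists>xs. X \<subseteq> set xs \<and> Rel xs (map \<pi> xs)"
  proof (rule back_and_forth[of Rel])
    show "Rel [] []"
      using is_iso_id[of L N] unfolding Rel_def append_Nil2 mv conjugate_def
      by (intro always_eventually allI exI[of _ id]) simp
  next
    fix xs as assume "Rel xs as"
    then show "length xs = length as" by (rule RelD)
  next
    fix xs as i j assume R: "Rel xs as" and ij: "i < length xs" "j < length xs"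
    have "\<forall>\<^sub>F k in sequentially. settled ps \<omega> (set xs) k"
      by (rule eventually_settled[OF ps gen]) simp
    then have "\<forall>\<^sub>F k in sequentially. settled ps \<omega> (set xs) k \<and> conjugate L N (map (?v k) (ps @ xs)) (fs @ as)"
      using R unfolding Rel_def by (rule eventually_conj)
    then obtain k where k: "inj_on (?v k) (set xs)" "conjugate L N (map (?v k) (ps @ xs)) (fs @ as)"
      unfolding eventually_sequentially settled_def by blast
    obtain h where h: "is_iso L h N N" "map h (map (?v k) (ps @ xs)) = fs @ as"
      using k(2) unfolding conjugate_def by blast
    have "inj h" using h(1) by (simp add: is_iso_def bij_is_inj)
    have "map h (map (?v k) xs) = as" using h(2) mv ps RelD[OF R] by (simp add: marking_def)
    then have "as ! i = h (?v k (xs ! i))" "as ! j = h (?v k (xs ! j))" using ij by auto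
    then show "xs ! i = xs ! j \<longleftrightarrow> as ! i = as ! j"
      using k(1) ij \<open>inj h\<close> by (metis inj_eq inj_onD nth_mem)
  next
    fix xs as x assume R: "Rel xs as"
    have "\<forall>\<^sub>F k in sequentially. settled ps \<omega> (set (ps @ xs @ [x])) k"
      by (rule eventually_settled[OF ps gen]) simp
    then have "\<forall>\<^sub>F k in sequentially. settled ps \<omega> (set (ps @ xs @ [x])) k \<and> conjugate L N (map (?v k) (ps @ xs)) (fs @ as)"
      using R unfolding Rel_def by (rule eventually_conj)
    then obtain n where n: "settled ps \<omega> (set (ps @ xs @ [x])) n" "conjugate L N (map (?v n) (ps @ xs)) (fs @ as)"
      unfolding eventually_sequentially by blast
    obtain h where h: "is_iso L h N N" "map h (map (?v n) (ps @ xs)) = fs @ as"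
      using n(2) unfolding conjugate_def by blast
    \<comment> \<open>The automorphism matching the old tuple at stage \<open>n\<close> dictates the
      partner of \<open>x\<close>; as the longer tuple is settled, the match persists.\<close>
    have "conjugate L N (map (?v n) (ps @ xs @ [x])) (fs @ as @ [h (?v n x)])"
      using h unfolding conjugate_def by (intro exI[of _ h]) simp
    then have "conjugate L N (map (?v k) (ps @ xs @ [x])) (fs @ as @ [h (?v n x)])" if "n \<le> k" for k
      using conjugate_trans[OF conjugate_sym[OF settled_conjugate[OF ps n(1) that subset_refl]]] by blast
    then show "\<exists>a. Rel (xs @ [x]) (as @ [a])"
      unfolding Rel_def eventually_sequentially by blast
  next
    fix xs as b assume R: "Rel xs as"
    show "\<exists>x. Rel (xs @ [x]) (as @ [b])"
    proof (cases "b \<in> set (fs @ as)")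
      case True
      then obtain m where m: "m < length (fs @ as)" "(fs @ as) ! m = b" unfolding in_set_conv_nth by blast
      have len: "length (fs @ as) = length (ps @ xs)" using ps RelD[OF R] by (simp add: marking_def)
      have "conjugate L N (map (?v k) (ps @ xs @ [(ps @ xs) ! m])) (fs @ as @ [b])"
        if c: "conjugate L N (map (?v k) (ps @ xs)) (fs @ as)" for k
      proof -
        obtain h where h: "is_iso L h N N" "map h (map (?v k) (ps @ xs)) = fs @ as"
          using c unfolding conjugate_def by blast
        have "h (?v k ((ps @ xs) ! m)) = map h (map (?v k) (ps @ xs)) ! m"
          using m(1) len by (simp del: map_append map_map)
        then have "h (?v k ((ps @ xs) ! m)) = b" unfolding h(2) m(2) .
        then show ?thesis using h unfolding conjugate_def by (intro exI[of _ h]) simp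
      qed
      then have "Rel (xs @ [(ps @ xs) ! m]) (as @ [b])"
        using R unfolding Rel_def by (auto elim: eventually_mono)
      then show ?thesis ..
    next
      case False
      then have bF: "b \<notin> set fs" by simp
      \<comment> \<open>Beyond \<open>B\<close> and the length of the tuple, the demand for
        \<open>b\<close> is among those answered at stage \<open>k\<close>.\<close>
      define B where "B = Max (insert b (set (fs @ as)))"
      have B: "b \<le> B" "set (fs @ as) \<subseteq> {..B}" by (auto simp: B_def)
      have "\<forall>\<^sub>F k in sequentially. settled ps \<omega> (set (ps @ xs)) k"
        by (rule eventually_settled[OF ps gen]) simp
      moreover have "\<forall>\<^sub>F k in sequentially. max B (length (ps @ xs)) \<le> k"
        by (rule eventually_ge_at_top)
      moreover note R[unfolded Rel_def]
      ultimately have "\<forall>\<^sub>F k in sequentially. settled ps \<omega> (set (ps @ xs)) k \<and>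
          max B (length (ps @ xs)) \<le> k \<and> conjugate L N (map (?v k) (ps @ xs)) (fs @ as)"
        by eventually_elim blast
      then obtain k where k: "settled ps \<omega> (set (ps @ xs)) k" "B \<le> k" "length (ps @ xs) \<le> k"
        "conjugate L N (map (?v k) (ps @ xs)) (fs @ as)"
        unfolding eventually_sequentially by auto
      have sk: "settled ps \<omega> (set (ps @ xs)) (Suc k)"
        using settled_mono[OF ps k(1), of "Suc k"] by simp
      have conj: "conjugate L N (map (?v (Suc k)) (ps @ xs)) (fs @ as)"
        using conjugate_trans[OF conjugate_sym[OF settled_conjugate[OF ps k(1) _ subset_refl]] k(4)] by simp
      \<comment> \<open>The walks in the tuple have started by stage \<open>k\<close>, so at stage
        \<open>Suc k\<close> they have stayed or jumped and none has just been reset. This puts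
        their values where the witnesses were prepared.\<close>
      have in_T: "set (map (?v (Suc k)) (ps @ xs)) \<subseteq> set fs \<union> A k \<union> s k ` A k"
      proof -
        have "?v (Suc k) i \<in> set fs \<union> A k \<union> s k ` A k" if i: "i \<in> set (ps @ xs)" for i
        proof (cases "i \<in> set ps")
          case True
          then show ?thesis using val_in_fs[OF ps] by blast
        next
          case False
          then have "start (\<omega> i) \<le> k" using k(1) i unfolding settled_def by blast
          from walk_step[OF this] show ?thesis
            using walk_in[of "\<omega> i" k] by (simp add: val_unmarked[OF ps False])
        qed
        then show ?thesis by auto
      qed
      have "\<exists>w\<in>A (Suc k). conjugate L N (map (?v (Suc k)) (ps @ xs) @ [w]) ((fs @ as) @ [b])"
      proof (rule witnessesD[OF A_witnesses in_T _ _ _ bF conj])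
        show "length (map (?v (Suc k)) (ps @ xs)) \<le> k" using k(3) by (simp only: length_map)
        show "b \<le> k" using B(1) k(2) by (rule order_trans)
        show "set (fs @ as) \<subseteq> {..k}" using B(2) k(2) by (meson atMost_subset_iff order_trans)
      qed
      then obtain w where w: "w \<in> A (Suc k)"
        "conjugate L N (map (?v (Suc k)) (ps @ xs) @ [w]) ((fs @ as) @ [b])" by blast
      obtain h where h: "is_iso L h N N" "map h (map (?v (Suc k)) (ps @ xs) @ [w]) = (fs @ as) @ [b]"
        using w(2) unfolding conjugate_def by blast
      have hw: "h w = b" "map h (map (?v (Suc k)) (ps @ xs)) = fs @ as" using h(2) by simp_all
      \<comment> \<open>As \<open>b\<close> is not matched yet, its witness is not an occupied
        value, so adding a walk that starts at \<open>w\<close> keeps the values distinct.\<close>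
      have w_new: "w \<notin> ?v (Suc k) ` set (ps @ xs)"
      proof
        assume "w \<in> ?v (Suc k) ` set (ps @ xs)"
        then have "h w \<in> set (map h (map (?v (Suc k)) (ps @ xs)))" by auto
        then show False using False unfolding hw by blast
      qed
      have "infinite {j. \<omega> j 0 = prod_encode (Suc k, w)}" using gen by (simp add: generic_def)
      then obtain j where j: "\<omega> j 0 = prod_encode (Suc k, w)" "j \<notin> set (ps @ xs)"
        using finite_subset[OF subsetI List.finite_set, of "{j. \<omega> j 0 = prod_encode (Suc k, w)}" "ps @ xs"]
        by blast
      have start_j: "start (\<omega> j) = Suc k" "born (\<omega> j) = w" using j(1) by (simp_all add: start_def born_def)
      have val_j: "?v (Suc k) j = w"
        using walk_start[OF start_j(1)] start_j(2) w(1) j(2) by (simp add: val_unmarked[OF ps] del: walk.simps)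
      have "settled ps \<omega> (set (ps @ xs @ [j])) (Suc k)"
      proof -
        have "set (ps @ xs @ [j]) = insert j (set (ps @ xs))" by auto
        moreover have "?v (Suc k) j \<notin> ?v (Suc k) ` (set (ps @ xs) - {j})" using w_new val_j by blast
        ultimately show ?thesis
          using sk start_j(1) unfolding settled_def by (simp only: inj_on_insert) auto
      qed
      then have "conjugate L N (map (?v (Suc k)) (ps @ xs @ [j])) (map (?v n) (ps @ xs @ [j]))" if "Suc k \<le> n" for n
        using settled_conjugate[OF ps _ that subset_refl] by blast
      moreover have "conjugate L N (map (?v (Suc k)) (ps @ xs @ [j])) (fs @ as @ [b])"
        using w(2) val_j by simp
      ultimately have "conjugate L N (map (?v n) (ps @ xs @ [j])) (fs @ as @ [b])" if "Suc k \<le> n" for n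
        using conjugate_trans[OF conjugate_sym] that by blast
      then show ?thesis unfolding Rel_def eventually_sequentially by blast
    qed
  qed blast
  have ev: "\<forall>\<^sub>F k in sequentially. conjugate L N (map (?v k) (ps @ xs)) (fs @ map \<pi> xs)" for xs
  proof -
    obtain zs where zs: "set xs \<subseteq> set zs" "Rel zs (map \<pi> zs)" using \<pi>(2)[of "set xs"] by auto
    have "conjugate L N (map (?v k) (ps @ xs)) (fs @ map \<pi> xs)"
      if c: "conjugate L N (map (?v k) (ps @ zs)) (fs @ map \<pi> zs)" for k
    proof -
      obtain h where h: "is_iso L h N N" "map h (map (?v k) (ps @ zs)) = fs @ map \<pi> zs"
        using c unfolding conjugate_def by blast
      then have "map h fs = fs" "map (h \<circ> ?v k) zs = map \<pi> zs" using mv[of \<omega> k] ps by (simp_all add: marking_def)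
      then have "map h (map (?v k) (ps @ xs)) = fs @ map \<pi> xs"
        using mv[of \<omega> k] zs(1) by auto
      then show ?thesis using h(1) unfolding conjugate_def by blast
    qed
    then show ?thesis using zs(2) unfolding Rel_def by (auto elim: eventually_mono)
  qed
  show thesis
  proof
    \<comment> \<open>Applied to \<open>ps\<close> itself: the automorphism fixes \<open>fs\<close>
      in the first block, so the second block must equal \<open>fs\<close> too.\<close>
    obtain k where "conjugate L N (map (?v k) (ps @ ps)) (fs @ map \<pi> ps)"
      using ev[of ps] unfolding eventually_sequentially by blast
    then obtain h where h: "map h (map (?v k) (ps @ ps)) = fs @ map \<pi> ps" unfolding conjugate_def by blast
    then have "map h fs @ map h fs = fs @ map \<pi> ps" unfolding map_append mv .
    then show "map \<pi> ps = fs" by auto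
    show "\<forall>\<^sub>F k in sequentially. conjugate L N (map (?v k) xs) (map \<pi> xs)" for xs
      using ev[of xs]
    proof (rule eventually_mono)
      fix k assume "conjugate L N (map (?v k) (ps @ xs)) (fs @ map \<pi> xs)"
      then obtain h where h: "is_iso L h N N" "map h (map (?v k) (ps @ xs)) = fs @ map \<pi> xs"
        unfolding conjugate_def by blast
      then have "map h (map (?v k) xs) = map \<pi> xs" using mv[of \<omega> k] by simp
      then show "conjugate L N (map (?v k) xs) (map \<pi> xs)" using h(1) unfolding conjugate_def by blast
    qed
  qed (rule \<pi>(1))
qed

end

section \<open>The sample space\<close>

text \<open>The second Borel-Cantelli lemma for distinct coordinates: missing \<open>K\<close>
  consecutive events has probability at most \<open>(1 - \<delta>) ^ K\<close>.\<close>

lemma (in product_prob_space) AE_PiM_hits_infinitely_often: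
  fixes e :: "nat \<Rightarrow> 'i"
  assumes e: "inj e" "range e \<subseteq> I" and E: "\<And>k. E k \<in> sets (M (e k))"
    and \<delta>: "\<delta> > 0" "\<And>k. measure (M (e k)) (E k) \<ge> \<delta>"
  shows "AE \<omega> in Pi\<^sub>M I M. \<forall>n. \<exists>k\<ge>n. \<omega> (e k) \<in> E k"
proof -
  let ?P = "Pi\<^sub>M I M"
  have "AE \<omega> in ?P. \<exists>k\<ge>n. \<omega> (e k) \<in> E k" for n
  proof -
    define B where "B = {\<omega> \<in> space ?P. \<forall>k\<in>{n..}. \<omega> (e k) \<in> space (M (e k)) - E k}"
    have B: "B \<in> sets ?P"
      unfolding B_def using e E
      by (intro sets.sets_Collect_countable_All' sets_Collect_single) auto
    have "prob B \<le> (1 - \<delta>) ^ K" for K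
    proof -
      define J where "J = e ` {n..<n + K}"
      define Y where "Y i = space (M i) - E (inv e i)" for i
      have inv: "inv e (e k) = k" for k using e(1) by (simp add: inv_f_f)
      have Y: "Y i \<in> sets (M i)" if "i \<in> J" for i using that E by (auto simp: J_def Y_def inv)
      have "B \<subseteq> {\<omega> \<in> space ?P. \<forall>i\<in>J. \<omega> i \<in> Y i}" by (auto simp: B_def J_def Y_def inv)
      then have "prob B \<le> prob {\<omega> \<in> space ?P. \<forall>i\<in>J. \<omega> i \<in> Y i}"
        using Y e(2) by (intro finite_measure_mono sets.sets_Collect_finite_All sets_Collect_single) (auto simp: J_def)
      also have "\<dots> = (\<Prod>i\<in>J. measure (M i) (Y i))"
      proof -
        have "J \<subseteq> I" "finite J" using e(2) by (auto simp: J_def)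
        then show ?thesis
          using emeasure_PiM_Collect[of J Y] Y
          by (simp add: emeasure_eq_measure M.emeasure_eq_measure prod_ennreal prod_nonneg)
      qed
      also have "\<dots> = (\<Prod>k\<in>{n..<n + K}. measure (M (e k)) (Y (e k)))"
        unfolding J_def using e(1) by (intro prod.reindex_cong[of e]) (auto intro: inj_on_subset)
      also have "\<dots> \<le> (\<Prod>k\<in>{n..<n + K}. 1 - \<delta>)"
      proof (intro prod_mono conjI)
        fix k
        have "measure (M (e k)) (Y (e k)) = 1 - measure (M (e k)) (E k)"
          unfolding Y_def inv by (rule M.prob_compl[OF E])
        then show "measure (M (e k)) (Y (e k)) \<le> 1 - \<delta>" using \<delta>(2)[of k] by simp
      qed simp
      finally show ?thesis by simp
    qed
    moreover have "\<delta> \<le> 1" using \<delta>(2)[of 0] M.prob_le_1[of "e 0" "E 0"] by linarith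
    then have "(\<lambda>K. (1 - \<delta>) ^ K) \<longlonglongrightarrow> 0" using \<delta>(1) by (intro LIMSEQ_power_zero) auto
    ultimately have "prob B \<le> 0" by (intro LIMSEQ_le_const[of _ 0]) auto
    then have "B \<in> null_sets ?P" using B by (auto simp: null_sets_def emeasure_eq_measure intro: antisym)
    moreover have "{\<omega> \<in> space ?P. \<not> (\<exists>k\<ge>n. \<omega> (e k) \<in> E k)} \<subseteq> B"
      using e(2) by (auto simp: B_def space_PiM)
    ultimately show ?thesis by (rule AE_I')
  qed
  then show ?thesis by (simp add: AE_all_countable)
qed

lemma (in product_prob_space) distr_PiM_pair:
  assumes ij: "i \<in> I" "j \<in> I" "i \<noteq> j"
  shows "distr (Pi\<^sub>M I M) (M i \<Otimes>\<^sub>M M j) (\<lambda>\<omega>. (\<omega> i, \<omega> j)) = M i \<Otimes>\<^sub>M M j"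
proof (rule pair_measure_eqI[symmetric])
  fix A B assume AB: "A \<in> sets (M i)" "B \<in> sets (M j)"
  let ?X = "\<lambda>k. if k = i then A else B"
  have "emeasure (distr (Pi\<^sub>M I M) (M i \<Otimes>\<^sub>M M j) (\<lambda>\<omega>. (\<omega> i, \<omega> j))) (A \<times> B) =
      emeasure (Pi\<^sub>M I M) {\<omega> \<in> space (Pi\<^sub>M I M). \<forall>k\<in>{i, j}. \<omega> k \<in> ?X k}"
    using ij AB by (subst emeasure_distr) (auto intro!: arg_cong2[where f=emeasure])
  also have "\<dots> = (\<Prod>k\<in>{i, j}. emeasure (M k) (?X k))"
    using ij AB by (intro emeasure_PiM_Collect) auto
  also have "\<dots> = emeasure (M i) A * emeasure (M j) B" using ij by simp
  finally show "emeasure (M i) A * emeasure (M j) B =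
      emeasure (distr (Pi\<^sub>M I M) (M i \<Otimes>\<^sub>M M j) (\<lambda>\<omega>. (\<omega> i, \<omega> j))) (A \<times> B)" ..
qed (auto intro: M.sigma_finite_measure_axioms)

text \<open>A convenient law charging every natural. It serves for the starting labels, for the
  coins, which need not be fair, and for the weights of the positions of \<open>F\<close>.\<close>

definition mass :: "nat pmf" where "mass = geometric_pmf (1/2)"

lemma mass_pos: "pmf mass n > 0"
  by (simp add: mass_def pmf_geometric)

definition draws :: "(nat \<Rightarrow> nat) measure" where "draws = (\<Pi>\<^sub>M k\<in>UNIV. measure_pmf mass)"
definition samples :: "(nat \<Rightarrow> nat \<Rightarrow> nat) measure" where "samples = (\<Pi>\<^sub>M i\<in>UNIV. draws)"

interpretation draws: product_prob_space "\<lambda>_ :: nat. measure_pmf mass" UNIV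
  by unfold_locales

lemma prob_space_draws: "prob_space draws"
  unfolding draws_def by (rule draws.prob_space_axioms)

interpretation samples: product_prob_space "\<lambda>_ :: nat. draws" UNIV
  using prob_space_draws by (intro product_prob_spaceI)

lemma prob_space_samples: "prob_space samples"
  unfolding samples_def by (rule samples.prob_space_axioms)

lemma space_draws [simp]: "space draws = UNIV"
  by (simp add: draws_def space_PiM)

lemma space_samples [simp]: "space samples = UNIV"
  by (simp add: samples_def space_PiM)

lemma measurable_draws_component [measurable]: "(\<lambda>\<sigma>. \<sigma> k) \<in> draws \<rightarrow>\<^sub>M count_space UNIV"
proof -
  have "(\<lambda>\<sigma>. \<sigma> k) \<in> draws \<rightarrow>\<^sub>M measure_pmf mass"
    unfolding draws_def by (rule measurable_component_singleton) simp
  then show ?thesis by simp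
qed

lemma measurable_samples_component [measurable]: "(\<lambda>\<omega>. \<omega> i) \<in> samples \<rightarrow>\<^sub>M draws"
  unfolding samples_def by (rule measurable_component_singleton) simp

lemma measurable_sample [measurable]: "(\<lambda>\<omega>. \<omega> i k) \<in> samples \<rightarrow>\<^sub>M count_space UNIV"
  using measurable_compose[OF measurable_samples_component measurable_draws_component] .

lemma AE_labels: "AE \<omega> in samples. \<forall>m. infinite {j. \<omega> j 0 = m}"
proof -
  have "AE \<omega> in samples. infinite {j. \<omega> j 0 = m}" for m
  proof -
    have E: "{\<sigma> \<in> space draws. \<sigma> 0 = m} \<in> sets draws" by measurable
    have "emeasure draws {\<sigma> \<in> space draws. \<sigma> 0 \<in> {m}} = emeasure (measure_pmf mass) {m}"
      unfolding draws_def by (rule draws.emeasure_PiM_Collect_single) auto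
    then have "measure draws {\<sigma> \<in> space draws. \<sigma> 0 = m} = pmf mass m"
      by (simp add: measure_def emeasure_pmf_single)
    then have "AE \<omega> in samples. \<forall>n. \<exists>j\<ge>n. \<omega> (id j) \<in> {\<sigma> \<in> space draws. \<sigma> 0 = m}"
      unfolding samples_def
      by (intro samples.AE_PiM_hits_infinitely_often[where \<delta> = "pmf mass m"]) (use E mass_pos in auto)
    then show ?thesis
      by eventually_elim (auto simp: infinite_nat_iff_unbounded_le)
  qed
  then show ?thesis by (simp add: AE_all_countable)
qed

text \<open>By independence the two walks may be treated one after the other: the first sequence is
  fixed, and the second disagrees with it at each index with a probability bounded below.\<close>

lemma AE_coins:
  assumes ij: "i \<noteq> j"
  shows "AE \<omega> in samples. \<forall>n. \<exists>k\<ge>n. coin (\<omega> i) k \<noteq> coin (\<omega> j) k"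
proof -
  define H where "H = (\<lambda>(\<sigma>, \<tau>). \<forall>n. \<exists>k\<ge>n. coin \<sigma> k \<noteq> coin \<tau> k)"
  have H [measurable]: "Measurable.pred (draws \<Otimes>\<^sub>M draws) H"
    unfolding H_def coin_def by measurable
  interpret draws': prob_space draws by (rule prob_space_draws)
  interpret pair: pair_sigma_finite draws draws ..
  have "AE \<tau> in draws. H (\<sigma>, \<tau>)" for \<sigma>
  proof -
    \<comment> \<open>One of \<open>0\<close> and \<open>1\<close> has the parity opposite to that
      of \<open>\<sigma> k\<close>, so \<open>\<delta>\<close> bounds the chance of disagreement for
      either parity.\<close>
    define \<delta> where "\<delta> = min (pmf mass 0) (pmf mass 1)"
    have "measure_pmf.prob mass {x. odd x \<noteq> odd (\<sigma> k)} \<ge> \<delta>" for k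
    proof -
      obtain x :: nat where x: "x \<in> {0, 1}" "odd x \<noteq> odd (\<sigma> k)"
        by (cases "odd (\<sigma> k)") (auto intro: that[of 0] that[of 1])
      then have "\<delta> \<le> measure_pmf.prob mass {x}" by (auto simp: \<delta>_def measure_pmf_single)
      also have "\<dots> \<le> measure_pmf.prob mass {x. odd x \<noteq> odd (\<sigma> k)}"
        using x(2) by (intro measure_pmf.finite_measure_mono) auto
      finally show ?thesis .
    qed
    moreover have "\<delta> > 0" by (simp add: \<delta>_def mass_pos)
    ultimately have "AE \<tau> in draws. \<forall>n. \<exists>k\<ge>n. \<tau> (id k) \<in> {x. odd x \<noteq> odd (\<sigma> k)}"
      unfolding draws_def
      by (intro draws.AE_PiM_hits_infinitely_often[where \<delta> = \<delta>]) auto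
    then show ?thesis
    proof eventually_elim
      case (elim \<tau>)
      show ?case
        unfolding H_def coin_def prod.case
      proof
        fix n
        \<comment> \<open>Coin \<open>k\<close> is read at index \<open>Suc k\<close>, since index
          \<open>0\<close> holds the label.\<close>
        obtain k where k: "k \<ge> Suc n" "odd (\<tau> k) \<noteq> odd (\<sigma> k)" using elim by auto
        then obtain k' where "k = Suc k'" by (cases k) auto
        with k show "\<exists>k\<ge>n. odd (\<sigma> (Suc k)) \<noteq> odd (\<tau> (Suc k))" by auto
      qed
    qed
  qed
  then have "AE x in draws \<Otimes>\<^sub>M draws. H x"
    by (intro pair.AE_pair_measure) auto
  moreover have "distr samples (draws \<Otimes>\<^sub>M draws) (\<lambda>\<omega>. (\<omega> i, \<omega> j)) = draws \<Otimes>\<^sub>M draws"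
    unfolding samples_def by (rule samples.distr_PiM_pair) (use ij in auto)
  ultimately have ae: "AE x in distr samples (draws \<Otimes>\<^sub>M draws) (\<lambda>\<omega>. (\<omega> i, \<omega> j)). H x"
    by (simp only:)
  have "(\<lambda>\<omega>. (\<omega> i, \<omega> j)) \<in> samples \<rightarrow>\<^sub>M draws \<Otimes>\<^sub>M draws" by measurable
  from AE_distrD[OF this ae] have "AE \<omega> in samples. H (\<omega> i, \<omega> j)" .
  then show ?thesis by (simp only: H_def prod.case)
qed

lemma AE_generic: "AE \<omega> in samples. generic \<omega>"
proof -
  have "AE \<omega> in samples. \<forall>i j. i \<noteq> j \<longrightarrow> (\<forall>n. \<exists>k\<ge>n. coin (\<omega> i) k \<noteq> coin (\<omega> j) k)"
    using AE_coins by (simp add: AE_all_countable)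
  with AE_labels show ?thesis by eventually_elim (simp add: generic_def)
qed

lemma pred_generic [measurable]: "Measurable.pred samples generic"
  unfolding generic_def[abs_def] coin_def infinite_nat_iff_unbounded by measurable

definition relabel :: "(nat \<Rightarrow> nat) \<Rightarrow> (nat \<Rightarrow> nat \<Rightarrow> nat) \<Rightarrow> nat \<Rightarrow> nat \<Rightarrow> nat" where
  "relabel g \<omega> i = \<omega> (inv g i)"

lemma distr_samples_relabel:
  assumes "bij g"
  shows "distr samples samples (relabel g) = samples"
proof -
  have "distr (Pi\<^sub>M UNIV (\<lambda>_. draws)) (\<Pi>\<^sub>M i\<in>UNIV. draws) (\<lambda>\<omega>. \<lambda>n\<in>UNIV. \<omega> (inv g n)) = (\<Pi>\<^sub>M i\<in>UNIV. draws)"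
    using bij_imp_bij_inv[OF assms] by (intro distr_PiM_reindex prob_space_draws) (auto simp: bij_def)
  then show ?thesis by (simp add: samples_def relabel_def[abs_def] restrict_UNIV)
qed

lemma measurable_relabel [measurable]: "relabel g \<in> samples \<rightarrow>\<^sub>M samples"
  unfolding samples_def relabel_def[abs_def]
  by (intro measurable_PiM_single') (auto simp: space_PiM)

section \<open>Random positions for the algebraic part\<close>

definition markings :: "nat \<Rightarrow> nat list pmf" where
  "markings n = cond_pmf (replicate_pmf n mass) {ps. distinct ps}"

definition weight :: "nat set \<Rightarrow> real" where
  "weight X = (\<Prod>x\<in>X. pmf mass x)"

lemma weight_pos: "weight X > 0"
  unfolding weight_def by (intro prod_pos) (simp add: mass_pos)

lemma pmf_replicate_pmf:
  "pmf (replicate_pmf n p) xs = (if length xs = n then (\<Prod>x\<leftarrow>xs. pmf p x) else 0)"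
proof (induction n arbitrary: xs)
  case (Suc n)
  have eq: "replicate_pmf (Suc n) p = map_pmf (\<lambda>(x, xs). x # xs) (pair_pmf p (replicate_pmf n p))"
    by (simp add: map_pmf_def pair_pmf_def bind_assoc_pmf bind_return_pmf)
  show ?case
  proof (cases xs)
    case Nil
    then have "xs \<notin> (\<lambda>(x, xs). x # xs) ` set_pmf (pair_pmf p (replicate_pmf n p))" by auto
    then show ?thesis using Nil unfolding eq by (simp add: pmf_map_outside)
  next
    case (Cons y ys)
    have "inj (\<lambda>(x :: 'a, xs). x # xs)" by (auto simp: inj_on_def)
    from pmf_map_inj'[OF this, of "pair_pmf p (replicate_pmf n p)" "(y, ys)"]
    show ?thesis unfolding eq Cons by (simp add: pmf_pair Suc.IH)
  qed
qed (simp add: pmf_return)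

lemma pmf_markings:
  obtains Z where "Z > 0"
    "\<And>ps. pmf (markings n) ps = (if distinct ps \<and> length ps = n then weight (set ps) / Z else 0)"
proof -
  let ?R = "replicate_pmf n mass"
  have mass_set: "set_pmf mass = UNIV" using mass_pos[THEN less_imp_neq] by (auto simp: set_pmf_iff)
  have "[0..<n] \<in> set_pmf ?R \<inter> {ps. distinct ps}" by (simp add: set_replicate_pmf mass_set)
  then have ne: "set_pmf ?R \<inter> {ps. distinct ps} \<noteq> {}" by blast
  have pmf: "pmf (markings n) ps = (if distinct ps \<and> length ps = n then weight (set ps) / measure_pmf.prob ?R {ps. distinct ps} else 0)" for ps
    unfolding markings_def
    using prod.distinct_set_conv_list[of ps "pmf mass"]
    by (simp add: pmf_cond[OF ne] pmf_replicate_pmf weight_def)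
  have "measure_pmf.prob ?R {ps. distinct ps} > 0"
    using measure_pmf_posI[of "[0..<n]" ?R "{ps. distinct ps}"] by (simp add: set_replicate_pmf mass_set)
  then show thesis using that pmf by blast
qed

lemma AE_markings: "AE ps in measure_pmf (markings n). distinct ps \<and> length ps = n"
proof -
  obtain Z where "\<And>ps. pmf (markings n) ps = (if distinct ps \<and> length ps = n then weight (set ps) / Z else 0)"
    using pmf_markings[of n] by metis
  then show ?thesis by (auto simp: AE_measure_pmf_iff set_pmf_iff split: if_splits)
qed

text \<open>A permutation preserves length and distinctness, so the normalising constant cancels and
  only the weights of the two underlying sets remain.\<close>

lemma distr_markings:
  assumes g: "bij g"
  shows "distr (measure_pmf (markings n)) (count_space UNIV) (map g) =
    density (measure_pmf (markings n)) (\<lambda>ps. ennreal (weight (inv g ` set ps) / weight (set ps)))"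
proof (rule measure_eqI_countable[where A=UNIV])
  fix ps :: "nat list"
  let ?f = "\<lambda>ps. ennreal (weight (inv g ` set ps) / weight (set ps))"
  obtain Z where Z: "Z > 0"
    "\<And>ps. pmf (markings n) ps = (if distinct ps \<and> length ps = n then weight (set ps) / Z else 0)"
    using pmf_markings[of n] by metis
  have "emeasure (distr (measure_pmf (markings n)) (count_space UNIV) (map g)) {ps}
      = emeasure (measure_pmf (map_pmf (map g) (markings n))) {map g (map (inv g) ps)}"
    unfolding map_pmf_rep_eq bij_map_inv[OF g] ..
  also have "\<dots> = ennreal (pmf (markings n) (map (inv g) ps))"
    unfolding emeasure_pmf_single by (subst pmf_map_inj') (use g in \<open>auto simp: bij_is_inj\<close>)
  also have "\<dots> = ?f ps * ennreal (pmf (markings n) ps)"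
    using Z(1) weight_pos[of "set ps", THEN less_imp_neq, THEN not_sym] inj_on_subset[OF bij_is_inj[OF bij_imp_bij_inv[OF g]]]
    by (simp add: Z(2) distinct_map ennreal_mult'' [symmetric] less_imp_le weight_pos)
  also have "\<dots> = (\<integral>\<^sup>+ x. ?f ps * indicator {ps} x \<partial>measure_pmf (markings n))"
    by (simp add: nn_integral_cmult emeasure_pmf_single)
  also have "\<dots> = (\<integral>\<^sup>+ x. ?f x * indicator {ps} x \<partial>measure_pmf (markings n))"
    by (intro nn_integral_cong) (auto simp: indicator_def)
  also have "\<dots> = emeasure (density (measure_pmf (markings n)) ?f) {ps}"
    by (simp add: emeasure_density)
  finally show "emeasure (distr (measure_pmf (markings n)) (count_space UNIV) (map g)) {ps} =
    emeasure (density (measure_pmf (markings n)) ?f) {ps}" .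
qed auto

section \<open>The random structure\<close>

lemma conjugate_rel:
  assumes "conjugate L N xs ys" "R \<in> Rel L" "xs \<in> tuples (rel_ar L R)"
  shows "fst N R xs \<longleftrightarrow> fst N R ys"
  using assms unfolding conjugate_def is_iso_def by blast

lemma conjugate_fun:
  assumes "conjugate L N (xs @ [x]) (ys @ [y])" "f \<in> Fun L" "xs \<in> tuples (fun_ar L f)"
  shows "snd N f xs = x \<longleftrightarrow> snd N f ys = y"
proof -
  obtain h where h: "is_iso L h N N" "map h xs = ys" "h x = y"
    using assms(1) unfolding conjugate_def by auto
  have "h (snd N f xs) = snd N f ys" using h(1,2) assms(2,3) unfolding is_iso_def by blast
  moreover have "inj h" using h(1) by (simp add: is_iso_def bij_is_inj)
  ultimately show ?thesis using h(3) by (metis injD)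
qed

lemma eventually_iff_const:
  assumes "\<forall>\<^sub>F k in sequentially. P k \<longleftrightarrow> b"
  shows "(\<forall>\<^sub>F k in sequentially. P k) \<longleftrightarrow> b"
  using eventually_cong[OF assms] by simp

text \<open>Describes the limit through the values alone, without the isomorphism to
  \<open>N\<close>; measurability and equivariance can then be read off. A function value in
  \<open>M\<close> is a position, hence the comparison with \<open>v k y\<close>.\<close>

definition is_limit ::
    "('r, 'f) language \<Rightarrow> ('r, 'f) struct \<Rightarrow> (nat \<Rightarrow> nat \<Rightarrow> nat) \<Rightarrow> ('r, 'f) struct \<Rightarrow> bool" where
  "is_limit L N v M \<longleftrightarrow> M \<in> Str L \<and>
    (\<forall>R\<in>Rel L. \<forall>xs\<in>tuples (rel_ar L R).
       fst M R xs \<longleftrightarrow> (\<forall>\<^sub>F k in sequentially. fst N R (map (v k) xs))) \<and>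
    (\<forall>f\<in>Fun L. \<forall>xs\<in>tuples (fun_ar L f). \<forall>y.
       snd M f xs = y \<longleftrightarrow> (\<forall>\<^sub>F k in sequentially. snd N f (map (v k) xs) = v k y))"

lemma is_limit_unique:
  assumes "is_limit L N v M" "is_limit L N v M'"
  shows "M = M'"
proof (rule Str_eqI)
  fix R xs assume "R \<in> Rel L" "xs \<in> tuples (rel_ar L R)"
  then show "fst M R xs = fst M' R xs" using assms unfolding is_limit_def by blast
next
  fix f xs assume "f \<in> Fun L" "xs \<in> tuples (fun_ar L f)"
  then show "snd M f xs = snd M' f xs" using assms unfolding is_limit_def by blast
qed (use assms in \<open>unfold is_limit_def, blast+\<close>)

lemma is_limit_act:
  assumes lim: "is_limit L N v M" and g: "bij g"
  shows "is_limit L N (\<lambda>k i. v k (inv g i)) (logic_act L g M)"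
  unfolding is_limit_def
proof (intro conjI ballI allI)
  show "logic_act L g M \<in> Str L" by (rule logic_act_in_Str)
next
  fix R xs assume R: "R \<in> Rel L" "xs \<in> tuples (rel_ar L R)"
  then have "map (inv g) xs \<in> tuples (rel_ar L R)" by simp
  then have "fst M R (map (inv g) xs) \<longleftrightarrow> (\<forall>\<^sub>F k in sequentially. fst N R (map (v k) (map (inv g) xs)))"
    using lim R(1) unfolding is_limit_def by blast
  then show "fst (logic_act L g M) R xs \<longleftrightarrow> (\<forall>\<^sub>F k in sequentially. fst N R (map (\<lambda>i. v k (inv g i)) xs))"
    by (simp add: logic_act_rel[OF R] o_def)
next
  fix f xs y assume f: "f \<in> Fun L" "xs \<in> tuples (fun_ar L f)"
  then have "map (inv g) xs \<in> tuples (fun_ar L f)" by simp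
  then have "snd M f (map (inv g) xs) = inv g y \<longleftrightarrow>
      (\<forall>\<^sub>F k in sequentially. snd N f (map (v k) (map (inv g) xs)) = v k (inv g y))"
    using lim f(1) unfolding is_limit_def by blast
  moreover have "g (snd M f (map (inv g) xs)) = y \<longleftrightarrow> snd M f (map (inv g) xs) = inv g y"
    using g by (metis bij_inv_eq_iff)
  ultimately show "snd (logic_act L g M) f xs = y \<longleftrightarrow>
      (\<forall>\<^sub>F k in sequentially. snd N f (map (\<lambda>i. v k (inv g i)) xs) = v k (inv g y))"
    by (simp add: logic_act_fun[OF f] o_def)
qed

lemma map_of_zip_map_bij:
  "bij g \<Longrightarrow> map_of (zip (map g xs) ys) i = map_of (zip xs ys) (inv g i)"
  by (induction xs ys rule: list_induct2') (auto simp: bij_inv_eq_iff bij_is_inj inv_f_f bij_is_surj surj_f_inv_f)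

lemma measurable_count_space2:
  fixes F :: "'b :: countable \<Rightarrow> 'c :: countable \<Rightarrow> 'd"
  assumes f: "f \<in> X \<rightarrow>\<^sub>M count_space UNIV" and g: "g \<in> X \<rightarrow>\<^sub>M count_space UNIV"
  shows "(\<lambda>x. F (f x) (g x)) \<in> X \<rightarrow>\<^sub>M count_space UNIV"
proof (rule measurable_compose_countable[OF _ f])
  fix b show "(\<lambda>x. F b (g x)) \<in> X \<rightarrow>\<^sub>M count_space UNIV"
    by (rule measurable_compose[OF g]) simp
qed

lemma measurable_map_count_space:
  fixes v :: "'x \<Rightarrow> 'i \<Rightarrow> nat"
  assumes "\<And>i. (\<lambda>x. v x i) \<in> X \<rightarrow>\<^sub>M count_space UNIV"
  shows "(\<lambda>x. map (v x) is) \<in> X \<rightarrow>\<^sub>M count_space UNIV"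
proof (induction "is")
  case (Cons i "is")
  show ?case using measurable_count_space2[OF assms[of i] Cons, of Cons] by simp
qed simp

section \<open>Existence, measurability and equivariance of the random structure\<close>

context staged
begin

text \<open>A walk depends only on its driving sequence, not on the position that carries
  it.\<close>

lemma val_relabel:
  assumes "bij g"
  shows "val (map g ps) (relabel g \<omega>) k i = val ps \<omega> k (inv g i)"
  by (cases "map_of (zip ps fs) (inv g i)") (simp_all add: val_def relabel_def map_of_zip_map_bij[OF assms])

lemma is_limit_exists:
  assumes "marking ps" "generic \<omega>"
  shows "\<exists>M \<pi>. is_limit L N (val ps \<omega>) M \<and> is_iso L \<pi> M N \<and> map \<pi> ps = fs"
proof -
  obtain \<pi> where \<pi>: "bij \<pi>" "map \<pi> ps = fs"
    "\<And>xs. \<forall>\<^sub>F k in sequentially. conjugate L N (map (val ps \<omega> k) xs) (map \<pi> xs)"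
    by (rule limit_exists[OF assms]) blast
  define M where "M = logic_act L (inv \<pi>) N"
  have "is_iso L (inv \<pi>) N M" unfolding M_def by (rule is_iso_logic_act[OF bij_imp_bij_inv[OF \<pi>(1)]])
  from is_iso_inv[OF this] have iso: "is_iso L \<pi> M N" using \<pi>(1) by (simp add: inv_inv_eq)
  have "is_limit L N (val ps \<omega>) M"
    unfolding is_limit_def
  proof (intro conjI ballI allI)
    show "M \<in> Str L" unfolding M_def by (rule logic_act_in_Str)
  next
    fix R xs assume R: "R \<in> Rel L" "xs \<in> tuples (rel_ar L R)"
    have "\<forall>\<^sub>F k in sequentially. fst N R (map (val ps \<omega> k) xs) \<longleftrightarrow> fst N R (map \<pi> xs)"
      \<comment> \<open>The truth value at stage \<open>k\<close> becomes constant, so a statement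
        false in the limit is eventually false and in particular not eventually true.\<close>
      using \<pi>(3)[of xs] by (rule eventually_mono) (rule conjugate_rel, use R in simp_all)
    from eventually_iff_const[OF this]
    show "fst M R xs \<longleftrightarrow> (\<forall>\<^sub>F k in sequentially. fst N R (map (val ps \<omega> k) xs))"
      using iso R unfolding is_iso_def by blast
  next
    fix f xs y assume f: "f \<in> Fun L" "xs \<in> tuples (fun_ar L f)"
    have "\<forall>\<^sub>F k in sequentially. snd N f (map (val ps \<omega> k) xs) = val ps \<omega> k y \<longleftrightarrow> snd N f (map \<pi> xs) = \<pi> y"
      using \<pi>(3)[of "xs @ [y]"] by (rule eventually_mono) (rule conjugate_fun, use f in simp_all)
    from eventually_iff_const[OF this]
    have "(\<forall>\<^sub>F k in sequentially. snd N f (map (val ps \<omega> k) xs) = val ps \<omega> k y) \<longleftrightarrow> snd N f (map \<pi> xs) = \<pi> y" .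
    moreover have "\<pi> (snd M f xs) = snd N f (map \<pi> xs)" using iso f unfolding is_iso_def by blast
    ultimately show "snd M f xs = y \<longleftrightarrow> (\<forall>\<^sub>F k in sequentially. snd N f (map (val ps \<omega> k) xs) = val ps \<omega> k y)"
      using inj_eq[OF bij_is_inj[OF \<pi>(1)], of "snd M f xs" y] by simp
  qed
  with iso \<pi>(2) show ?thesis by blast
qed

definition good :: "nat list \<times> (nat \<Rightarrow> nat \<Rightarrow> nat) \<Rightarrow> bool" where
  "good x \<longleftrightarrow> marking (fst x) \<and> generic (snd x)"

text \<open>The default \<open>N\<close> keeps the value in the isomorphism class even on the
  exceptional null set.\<close>

definition limit :: "nat list \<times> (nat \<Rightarrow> nat \<Rightarrow> nat) \<Rightarrow> ('r, 'f) struct" where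
  "limit x = (if good x then THE M. is_limit L N (val (fst x) (snd x)) M else N)"

lemma limit_eq: "good x \<Longrightarrow> is_limit L N (val (fst x) (snd x)) M \<Longrightarrow> limit x = M"
  unfolding limit_def using is_limit_unique by (metis (mono_tags, lifting) the_equality)

lemma limit_good:
  assumes "good x"
  shows "is_limit L N (val (fst x) (snd x)) (limit x)" "\<exists>\<pi>. is_iso L \<pi> (limit x) N \<and> map \<pi> (fst x) = fs"
  using is_limit_exists[of "fst x" "snd x"] limit_eq[OF assms] assms unfolding good_def by metis+

lemma limit_in_Str: "limit x \<in> Str L"
  using limit_good(1)[of x] N by (cases "good x") (auto simp: is_limit_def limit_def)

lemma limit_in_iso_class: "limit x \<in> iso_class L N"
proof -
  have "\<exists>\<pi>. is_iso L \<pi> (limit x) N"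
  proof (cases "good x")
    case True
    then show ?thesis using limit_good(2) by blast
  next
    case False
    then have "limit x = N" by (simp add: limit_def)
    then show ?thesis using is_iso_id[of L N] by auto
  qed
  then show ?thesis using limit_in_Str unfolding iso_class_def by blast
qed

abbreviation omega :: "(nat list \<times> (nat \<Rightarrow> nat \<Rightarrow> nat)) measure" where
  "omega \<equiv> measure_pmf (markings (length fs)) \<Otimes>\<^sub>M samples"

lemma measurable_walk: "(\<lambda>\<sigma>. walk \<sigma> k) \<in> draws \<rightarrow>\<^sub>M count_space UNIV"
proof (induction k)
  case 0
  have "(\<lambda>\<sigma>. walk \<sigma> 0) = (\<lambda>\<sigma>. (\<lambda>m. if fst (prod_decode m) = 0 \<and> snd (prod_decode m) \<in> A 0
      then snd (prod_decode m) else (SOME a. a \<in> A 0)) (\<sigma> 0))"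
    by (simp only: walk.simps start_def born_def)
  also have "\<dots> \<in> draws \<rightarrow>\<^sub>M count_space UNIV"
    by (rule measurable_compose[OF measurable_draws_component]) simp
  finally show ?case .
next
  case (Suc k)
  let ?F = "\<lambda>m n. \<lambda>w. if fst (prod_decode m) = Suc k \<and> snd (prod_decode m) \<in> A (Suc k)
      then snd (prod_decode m) else if odd n then s k w else (w :: nat)"
  have "(\<lambda>\<sigma>. ?F (fst (\<sigma> 0, \<sigma> (Suc k))) (snd (\<sigma> 0, \<sigma> (Suc k))) (walk \<sigma> k)) \<in> draws \<rightarrow>\<^sub>M count_space UNIV"
  proof (rule measurable_count_space2[where F = "\<lambda>p. ?F (fst p) (snd p)"])
    show "(\<lambda>\<sigma>. (\<sigma> 0, \<sigma> (Suc k))) \<in> draws \<rightarrow>\<^sub>M count_space UNIV"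
      by (rule measurable_count_space2[OF measurable_draws_component measurable_draws_component])
  qed (rule Suc)
  moreover have "(\<lambda>\<sigma>. walk \<sigma> (Suc k)) = (\<lambda>\<sigma>. ?F (fst (\<sigma> 0, \<sigma> (Suc k))) (snd (\<sigma> 0, \<sigma> (Suc k))) (walk \<sigma> k))"
    by (simp only: walk.simps start_def born_def coin_def fst_conv snd_conv)
  ultimately show ?case by (simp only:)
qed

lemma measurable_fst_omega: "fst \<in> omega \<rightarrow>\<^sub>M count_space UNIV"
proof -
  have "fst \<in> omega \<rightarrow>\<^sub>M measure_pmf (markings (length fs))" by (rule measurable_fst)
  then show ?thesis by simp
qed

lemma measurable_val: "(\<lambda>x. val (fst x) (snd x) k i) \<in> omega \<rightarrow>\<^sub>M count_space UNIV"
proof (rule measurable_compose_countable[OF _ measurable_fst_omega])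
  fix ps
  show "(\<lambda>x. val ps (snd x) k i) \<in> omega \<rightarrow>\<^sub>M count_space UNIV"
  proof (cases "map_of (zip ps fs) i")
    case None
    have "(\<lambda>x. walk (snd x i) k) \<in> omega \<rightarrow>\<^sub>M count_space UNIV"
      by (intro measurable_compose[OF _ measurable_walk] measurable_compose[OF measurable_snd measurable_samples_component])
    then show ?thesis using None by (simp add: val_def)
  qed (simp add: val_def)
qed

lemma pred_val:
  "Measurable.pred omega (\<lambda>x. P (map (val (fst x) (snd x) k) xs))"
  by (rule measurable_compose[OF measurable_map_count_space[OF measurable_val]]) simp

lemma pred_eventually_val:
  "Measurable.pred omega (\<lambda>x. \<forall>\<^sub>F k in sequentially. P (map (val (fst x) (snd x) k) xs))"
proof -
  note pred_val [measurable]
  show ?thesis unfolding eventually_sequentially by measurable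
qed

lemma pred_good: "Measurable.pred omega good"
proof -
  have [measurable]: "Measurable.pred omega (\<lambda>x. marking (fst x))"
    by (rule measurable_compose[OF measurable_fst_omega]) simp
  show ?thesis unfolding good_def[abs_def] by measurable
qed

lemma measurable_limit: "limit \<in> omega \<rightarrow>\<^sub>M Str_borel L"
proof (rule measurable_Str_borelI[OF countable_L])
  show "limit \<in> space omega \<rightarrow> Str L" using limit_in_Str by blast
next
  fix R xs assume R: "R \<in> Rel L" "xs \<in> tuples (rel_ar L R)"
  note pred_good [measurable] pred_eventually_val [measurable]
  have "fst (limit x) R xs \<longleftrightarrow> (if good x then \<forall>\<^sub>F k in sequentially. fst N R (map (val (fst x) (snd x) k) xs) else fst N R xs)" for x
    using limit_good(1)[of x] R unfolding is_limit_def by (cases "good x") (simp, simp add: limit_def)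
  moreover have "{x \<in> space omega. if good x then \<forall>\<^sub>F k in sequentially. fst N R (map (val (fst x) (snd x) k) xs) else fst N R xs} \<in> sets omega"
    by measurable
  ultimately show "{x \<in> space omega. fst (limit x) R xs} \<in> sets omega" by (simp only:)
next
  fix f xs y assume f: "f \<in> Fun L" "xs \<in> tuples (fun_ar L f)"
  note pred_good [measurable] pred_eventually_val [measurable]
  have "snd (limit x) f xs = y \<longleftrightarrow> (if good x then \<forall>\<^sub>F k in sequentially. snd N f (map (val (fst x) (snd x) k) xs) = val (fst x) (snd x) k y else snd N f xs = y)" for x
    using limit_good(1)[of x] f unfolding is_limit_def by (cases "good x") (simp, simp add: limit_def)
  moreover have "{x \<in> space omega. if good x then \<forall>\<^sub>F k in sequentially. snd N f (map (val (fst x) (snd x) k) xs) = val (fst x) (snd x) k y else snd N f xs = y} \<in> sets omega"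
  proof -
    \<comment> \<open>The position \<open>y\<close> is put in front of the arguments, so that the
      equation becomes a predicate of one tuple of values.\<close>
    have [measurable]: "Measurable.pred omega (\<lambda>x. \<forall>\<^sub>F k in sequentially. snd N f (map (val (fst x) (snd x) k) xs) = val (fst x) (snd x) k y)"
      using pred_eventually_val[of "\<lambda>zs. snd N f (tl zs) = hd zs" "y # xs"] by simp
    show ?thesis by measurable
  qed
  ultimately show "{x \<in> space omega. snd (limit x) f xs = y} \<in> sets omega" by (simp only:)
qed

lemma prob_space_omega: "prob_space omega"
  by (intro prob_space_pair prob_space_samples prob_space_measure_pmf)

lemma AE_good: "AE x in omega. good x"
proof -
  interpret samples: prob_space samples by (rule prob_space_samples)
  interpret pair: pair_sigma_finite "measure_pmf (markings (length fs))" samples ..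
  show ?thesis
  proof (rule pair.AE_pair_measure)
    show "{x \<in> space omega. good x} \<in> sets omega" using pred_good by measurable
    show "AE ps in measure_pmf (markings (length fs)). AE \<omega> in samples. good (ps, \<omega>)"
      using AE_markings[of "length fs"]
    proof (rule eventually_mono)
      fix ps :: "nat list" assume "distinct ps \<and> length ps = length fs"
      then have "marking ps" by (simp add: marking_def)
      from AE_generic show "AE \<omega> in samples. good (ps, \<omega>)"
        by eventually_elim (simp add: good_def \<open>marking ps\<close>)
    qed
  qed
qed

definition move :: "(nat \<Rightarrow> nat) \<Rightarrow> nat list \<times> (nat \<Rightarrow> nat \<Rightarrow> nat) \<Rightarrow> nat list \<times> (nat \<Rightarrow> nat \<Rightarrow> nat)" where
  "move g = (\<lambda>(ps, \<omega>). (map g ps, relabel g \<omega>))"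

lemma measurable_move: "move g \<in> omega \<rightarrow>\<^sub>M omega"
  unfolding move_def by measurable

text \<open>The walks are independent and identically distributed, so relabelling them contributes
  the constant density \<open>1\<close>; only the marking changes its law.\<close>

lemma distr_move:
  assumes g: "bij g"
  shows "distr omega omega (move g) =
    density omega (\<lambda>x. ennreal (weight (inv g ` set (fst x)) / weight (set (fst x))))"
proof -
  let ?P = "measure_pmf (markings (length fs))"
  let ?r = "\<lambda>ps. ennreal (weight (inv g ` set ps) / weight (set ps))"
  interpret samples: prob_space samples by (rule prob_space_samples)
  have "distr omega omega (move g) = distr omega (count_space UNIV \<Otimes>\<^sub>M samples) (move g)"
    by (intro distr_cong refl sets_pair_measure_cong) simp_all
  also have "\<dots> = distr ?P (count_space UNIV) (map g) \<Otimes>\<^sub>M distr samples samples (relabel g)"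
    unfolding move_def
    by (rule pair_measure_distr[symmetric])
      (simp_all add: distr_samples_relabel[OF g] samples.sigma_finite_measure_axioms)
  also have "\<dots> = density ?P ?r \<Otimes>\<^sub>M density samples (\<lambda>_. 1)"
    by (simp add: distr_samples_relabel[OF g] distr_markings[OF g] density_1)
  also have "\<dots> = density omega (\<lambda>(ps, \<omega>). ?r ps * 1)"
    by (rule pair_measure_density) (simp_all add: density_1 samples.sigma_finite_measure_axioms)
  finally show ?thesis by (simp add: case_prod_beta')
qed

text \<open>Both sides are limits of the same values, and limits are unique.\<close>

lemma limit_move:
  assumes g: "bij g" and x: "good x" "good (move g x)"
  shows "limit (move g x) = logic_act L g (limit x)"
proof (rule limit_eq[OF x(2)])
  have "val (fst (move g x)) (snd (move g x)) = (\<lambda>k i. val (fst x) (snd x) k (inv g i))"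
    by (cases x) (simp add: move_def val_relabel[OF g] fun_eq_iff)
  with is_limit_act[OF limit_good(1)[OF x(1)] g]
  show "is_limit L N (val (fst (move g x)) (snd (move g x))) (logic_act L g (limit x))" by (simp only:)
qed

end

section \<open>Quasi-invariance, support and cocycle\<close>

text \<open>One permutation is picked for each pair of lists; intersecting with \<open>Sym\<close>
  discards picks for pairs that no permutation realises. A countable family is needed since only
  countable unions of null sets are known to be null.\<close>

lemma countable_dense_Sym:
  obtains D where "countable D" "D \<subseteq> Sym" "\<And>h Z. h \<in> Sym \<Longrightarrow> finite Z \<Longrightarrow> \<exists>g\<in>D. \<forall>z\<in>Z. g z = h z"
proof
  define pick where "pick p = (SOME g. bij g \<and> map g (fst p) = snd p)" for p :: "nat list \<times> nat list"
  define D where "D = range pick \<inter> Sym"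
  show "countable D" unfolding D_def by simp
  show "D \<subseteq> Sym" unfolding D_def by simp
  fix h :: "nat \<Rightarrow> nat" and Z :: "nat set" assume h: "h \<in> Sym" and "finite Z"
  then obtain zs where zs: "set zs = Z" using finite_list by blast
  have "bij h \<and> map h (fst (zs, map h zs)) = snd (zs, map h zs)" using h by (simp add: Sym_def)
  then have p: "bij (pick (zs, map h zs)) \<and> map (pick (zs, map h zs)) zs = map h zs"
    unfolding pick_def using someI[of "\<lambda>g. bij g \<and> map g (fst (zs, map h zs)) = snd (zs, map h zs)" h] by simp
  then have "pick (zs, map h zs) \<in> D" by (simp add: D_def Sym_def)
  moreover have "\<forall>z\<in>Z. pick (zs, map h zs) z = h z" using p zs by auto
  ultimately show "\<exists>g\<in>D. \<forall>z\<in>Z. g z = h z" by blast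
qed

text \<open>Membership in an open set is ensured by finitely many atomic facts, and each of these
  depends on finitely many values of the permutation.\<close>

lemma logic_act_locally_constant:
  assumes U: "openin (Str_top L) U" and h: "h \<in> Sym" and M: "logic_act L h M \<in> U"
  obtains Z where "finite Z" "\<And>g. g \<in> Sym \<Longrightarrow> \<forall>z\<in>Z. g z = h z \<Longrightarrow> logic_act L g M \<in> U"
proof -
  obtain A B where AB: "finite A" "A \<subseteq> (SIGMA R:Rel L. tuples (rel_ar L R))"
    "finite B" "B \<subseteq> (SIGMA f:Fun L. tuples (fun_ar L f))"
    "\<And>M'. M' \<in> Str L \<Longrightarrow> (\<And>R xs. (R, xs) \<in> A \<Longrightarrow> fst M' R xs = fst (logic_act L h M) R xs) \<Longrightarrow>
       (\<And>f xs. (f, xs) \<in> B \<Longrightarrow> snd M' f xs = snd (logic_act L h M) f xs) \<Longrightarrow> M' \<in> U"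
    by (rule openin_Str_cylinder[OF U M]) blast
  define ZA where "ZA = (\<Union>p\<in>A. inv h ` set (snd p))"
  \<comment> \<open>For a function symbol \<open>g\<close> is also applied to the value, so that
    value is a further point where \<open>g\<close> and \<open>h\<close> must agree.\<close>
  define ZB where "ZB = (\<Union>p\<in>B. insert (snd M (fst p) (map (inv h) (snd p))) (inv h ` set (snd p)))"
  have bh: "bij h" using h by (simp add: Sym_def)
  have inv_eq: "map (inv g) xs = map (inv h) xs"
    if g: "g \<in> Sym" and eq: "\<forall>z\<in>inv h ` set xs. g z = h z" for g xs
  proof (rule map_cong[OF refl])
    fix x assume "x \<in> set xs"
    then have "g (inv h x) = x" using eq bh by (simp add: bij_is_surj surj_f_inv_f)
    then show "inv g x = inv h x" using g by (metis Sym_def bij_inv_eq_iff mem_Collect_eq)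
  qed
  show thesis
  proof (rule that[of "ZA \<union> ZB"])
    show "finite (ZA \<union> ZB)" using AB(1,3) by (simp add: ZA_def ZB_def)
    fix g assume g: "g \<in> Sym" and eq: "\<forall>z\<in>ZA \<union> ZB. g z = h z"
    show "logic_act L g M \<in> U"
    proof (rule AB(5)[OF logic_act_in_Str])
      fix R xs assume R: "(R, xs) \<in> A"
      then have "inv h ` set xs \<subseteq> ZA" unfolding ZA_def by force
      then have "map (inv g) xs = map (inv h) xs" using eq by (intro inv_eq[OF g]) blast
      moreover have "R \<in> Rel L" "xs \<in> tuples (rel_ar L R)" using R AB(2) by blast+
      ultimately show "fst (logic_act L g M) R xs = fst (logic_act L h M) R xs" by (simp only: logic_act_rel)
    next
      fix f xs assume f: "(f, xs) \<in> B"
      then have sub: "insert (snd M f (map (inv h) xs)) (inv h ` set xs) \<subseteq> ZB" unfolding ZB_def by force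
      then have "map (inv g) xs = map (inv h) xs" using eq by (intro inv_eq[OF g]) blast
      moreover have "g (snd M f (map (inv h) xs)) = h (snd M f (map (inv h) xs))" using sub eq by blast
      moreover have "f \<in> Fun L" "xs \<in> tuples (fun_ar L f)" using f AB(4) by blast+
      ultimately show "snd (logic_act L g M) f xs = snd (logic_act L h M) f xs" by (simp only: logic_act_fun)
    qed
  qed
qed

lemma iso_class_transitive:
  assumes "M \<in> iso_class L N" "M' \<in> iso_class L N"
  obtains h where "h \<in> Sym" "logic_act L h M' = M"
proof -
  obtain f g where f: "is_iso L f M N" and g: "is_iso L g M' N" and M: "M \<in> Str L"
    using assms unfolding iso_class_def by blast
  have iso: "is_iso L (inv f \<circ> g) M' M" by (rule is_iso_comp[OF g is_iso_inv[OF f]])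
  then have "bij (inv f \<circ> g)" by (simp add: is_iso_def)
  then show thesis using that[of "inv f \<circ> g"] iso logic_act_eq_iff[OF M] by (simp add: Sym_def)
qed

lemma continuous_on_Sym_inv_image:
  assumes "finite T"
  shows "continuous_on Sym (\<lambda>g. F (inv g ` T) :: real)"
  unfolding continuous_on_def
proof
  fix g0 :: "nat \<Rightarrow> nat" assume g0: "g0 \<in> Sym"
  define S where "S = (\<Inter>t\<in>T. (\<lambda>g :: nat \<Rightarrow> nat. g (inv g0 t)) -` {t})"
  have "open ((\<lambda>g :: nat \<Rightarrow> nat. g (inv g0 t)) -` {t})" for t
    by (rule open_vimage) (simp_all add: discrete_topology_class.open_discrete)
  then have "open S" unfolding S_def using assms by (intro open_INT) auto
  moreover have "g0 \<in> S" using g0 by (auto simp: S_def Sym_def bij_is_surj surj_f_inv_f)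
  moreover have "F (inv g ` T) = F (inv g0 ` T)" if "g \<in> S" "g \<in> Sym" for g
  proof -
    have "inv g t = inv g0 t" if "t \<in> T" for t
    proof (rule inv_f_eq)
      show "inj g" using \<open>g \<in> Sym\<close> by (simp add: Sym_def bij_is_inj)
      show "g (inv g0 t) = t" using \<open>g \<in> S\<close> that by (simp add: S_def)
    qed
    then have "inv g ` T = inv g0 ` T" by (intro image_cong refl)
    then show ?thesis by simp
  qed
  ultimately have "eventually (\<lambda>g. F (inv g ` T) = F (inv g0 ` T)) (at g0 within Sym)"
    unfolding eventually_at_topological by blast
  then show "((\<lambda>g. F (inv g ` T)) \<longlongrightarrow> F (inv g0 ` T)) (at g0 within Sym)"
    by (rule tendsto_eventually)
qed

section \<open>The density as a function of the structure\<close>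

context staged
begin

text \<open>Recovers the positions of \<open>F\<close> from their types. Asking instead for an
  isomorphism that sends \<open>x\<close> into \<open>F\<close> would not be evidently
  Borel.\<close>

definition marks :: "('r, 'f) struct \<Rightarrow> nat set" where
  "marks M = {x. \<exists>f\<in>set fs. isolates L N [f] M [x]}"

text \<open>Replacing an infinite set of marks by the empty one makes the density below a cocycle on all of
  \<open>Str L\<close>, not only on the isomorphism class.\<close>

definition finite_marks :: "('r, 'f) struct \<Rightarrow> nat set" where
  "finite_marks M = (if finite (marks M) then marks M else {})"

text \<open>By equivariance of \<open>finite_marks\<close> this is the coboundary
  \<open>w (g^-1 M) / w M\<close> of the weight \<open>w\<close> of the marks, so the cocycle
  identity is a telescoping product.\<close>

definition cocycle :: "(nat \<Rightarrow> nat) \<Rightarrow> ('r, 'f) struct \<Rightarrow> real" where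
  "cocycle g M = weight (inv g ` finite_marks M) / weight (finite_marks M)"

lemma finite_finite_marks: "finite (finite_marks M)"
  by (simp add: finite_marks_def)

lemma marks_act:
  assumes g: "bij g" and M: "M \<in> Str L"
  shows "marks (logic_act L g M) = g ` marks M"
proof -
  have "g x \<in> marks (logic_act L g M) \<longleftrightarrow> x \<in> marks M" for x
    using inv_pred_act[OF inv_pred_isolates g M, of N _ "[x]"] by (simp add: marks_def)
  then show ?thesis using bij_is_surj[OF g] by (auto simp: image_iff) (metis surjD)
qed

lemma finite_marks_act:
  assumes g: "bij g" and M: "M \<in> Str L"
  shows "finite_marks (logic_act L g M) = g ` finite_marks M"
  using marks_act[OF assms] finite_image_iff[OF bij_is_inj[OF g, THEN inj_on_subset[OF _ subset_UNIV]]]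
  by (simp add: finite_marks_def)

text \<open>Automorphisms may permute the elements of \<open>F\<close> but preserve
  \<open>F\<close>, so having the type of some element of \<open>F\<close> characterises the
  positions that carry \<open>F\<close>.\<close>

lemma marks_limit:
  assumes "good x"
  shows "marks (limit x) = set (fst x)"
proof -
  obtain \<pi> where \<pi>: "is_iso L \<pi> (limit x) N" "map \<pi> (fst x) = fs" using limit_good(2)[OF assms] by blast
  have bij: "bij \<pi>" using \<pi>(1) by (simp add: is_iso_def)
  have "isolates L N [f] (limit x) [y] \<longleftrightarrow> (\<exists>h. is_iso L h N N \<and> h f = \<pi> y)" for f y
    using inv_pred_iso[OF inv_pred_isolates \<pi>(1) limit_in_Str N, of N "[f]" "[y]"]
    by (simp add: isolates_iff indisc_iff_automorphism[OF countable_L N])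
  then have "y \<in> marks (limit x) \<longleftrightarrow> (\<exists>f\<in>set fs. \<exists>h. is_iso L h N N \<and> h f = \<pi> y)" for y
    by (simp add: marks_def)
  moreover have "(\<exists>f\<in>set fs. \<exists>h. is_iso L h N N \<and> h f = z) \<longleftrightarrow> z \<in> set fs" for z
    using algebraic_part_iso[of L _ N] is_iso_id[of L N] unfolding fs(1) by (metis id_apply)
  moreover have "\<pi> y \<in> set fs \<longleftrightarrow> y \<in> set (fst x)" for y
    using \<pi>(2) bij by (metis bij_is_inj inj_image_mem_iff list.set_map)
  ultimately show ?thesis by blast
qed

lemma finite_marks_limit: "good x \<Longrightarrow> finite_marks (limit x) = set (fst x)"
  by (simp add: finite_marks_def marks_limit)

lemma measurable_finite_marks: "finite_marks \<in> Str_borel L \<rightarrow>\<^sub>M count_space {T. finite T}"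
proof -
  have mark: "{M \<in> space (Str_borel L). x \<in> marks M} \<in> sets (Str_borel L)" for x
  proof -
    have "{M \<in> space (Str_borel L). \<exists>f\<in>set fs. isolates L N [f] M [x]} \<in> sets (Str_borel L)"
      using inv_predD[OF inv_pred_isolates] by (intro sets.sets_Collect_finite_Ex) simp_all
    then show ?thesis by (simp add: marks_def)
  qed
  have fin: "{M \<in> space (Str_borel L). infinite (marks M)} \<in> sets (Str_borel L)"
    unfolding infinite_nat_iff_unbounded
    by (intro sets.sets_Collect_countable_All sets.sets_Collect_countable_Ex sets.sets_Collect_conj
        sets.sets_Collect_const mark)
  have eq: "{M \<in> space (Str_borel L). \<forall>x. x \<in> marks M \<longleftrightarrow> x \<in> T} \<in> sets (Str_borel L)" for T
  proof (intro sets.sets_Collect_countable_All)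
    fix x
    show "{M \<in> space (Str_borel L). x \<in> marks M \<longleftrightarrow> x \<in> T} \<in> sets (Str_borel L)"
      using mark[of x] sets.sets_Collect_neg[OF mark[of x]] by (cases "x \<in> T") simp_all
  qed
  show ?thesis
  proof (subst measurable_count_space_eq_countable)
    show "countable {T :: nat set. finite T}" by (rule countable_Collect_finite)
    have "finite_marks -` {T} \<inter> space (Str_borel L) \<in> sets (Str_borel L)" if "finite T" for T
    proof -
      have "finite_marks -` {T} \<inter> space (Str_borel L) =
          {M \<in> space (Str_borel L). (\<forall>x. x \<in> marks M \<longleftrightarrow> x \<in> T) \<or> (T = {} \<and> infinite (marks M))}"
      proof -
        have "finite_marks M = T \<longleftrightarrow> marks M = T \<or> (T = {} \<and> infinite (marks M))" for M
          using that by (auto simp: finite_marks_def)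
        then show ?thesis unfolding set_eq_iff[of "marks _" T, symmetric] by blast
      qed
      also have "\<dots> \<in> sets (Str_borel L)"
        by (intro sets.sets_Collect_disj sets.sets_Collect_conj sets.sets_Collect_const eq fin)
      finally show ?thesis .
    qed
    then show "finite_marks \<in> space (Str_borel L) \<rightarrow> {T. finite T} \<and>
        (\<forall>a\<in>{T. finite T}. finite_marks -` {a} \<inter> space (Str_borel L) \<in> sets (Str_borel L))"
      using finite_finite_marks by blast
  qed
qed

lemma cocycle_pos: "cocycle g M > 0"
  by (simp add: cocycle_def weight_pos)

lemma cocycle_comp:
  assumes g: "g \<in> Sym" and h: "h \<in> Sym" and M: "M \<in> Str L"
  shows "cocycle (g \<circ> h) M = cocycle g M * cocycle h (logic_act L (inv g) M)"
proof -
  have "bij g" "bij h" using g h by (auto simp: Sym_def)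
  then have "inv (g \<circ> h) = inv h \<circ> inv g"
    "finite_marks (logic_act L (inv g) M) = inv g ` finite_marks M"
    using M by (simp_all add: o_inv_distrib finite_marks_act bij_imp_bij_inv)
  then show ?thesis
    using weight_pos[of "inv g ` finite_marks M"] by (simp add: cocycle_def image_comp)
qed

lemma continuous_cocycle: "continuous_on Sym (\<lambda>g. cocycle g M)"
  unfolding cocycle_def
  by (rule continuous_on_Sym_inv_image[OF finite_finite_marks, of "\<lambda>X. weight X / weight (finite_marks M)"])

text \<open>The structure enters only through its finite set of marks, which has countably many
  possible values; for each of them the dependence on \<open>g\<close> is continuous.\<close>

lemma measurable_cocycle:
  "(\<lambda>(g, M). cocycle g M) \<in> borel_measurable (restrict_space borel Sym \<Otimes>\<^sub>M Str_borel L)"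
proof -
  have "(\<lambda>x. (\<lambda>T x. weight (inv (fst x) ` T) / weight T) (finite_marks (snd x)) x)
      \<in> borel_measurable (restrict_space borel Sym \<Otimes>\<^sub>M Str_borel L)"
  proof (rule measurable_compose_countable'[where I = "{T. finite T}"])
    fix T :: "nat set" assume "T \<in> {T. finite T}"
    then have "(\<lambda>g. weight (inv g ` T) / weight T) \<in> borel_measurable (restrict_space borel Sym)"
      using continuous_on_Sym_inv_image[of T "\<lambda>X. weight X / weight T"]
      by (intro borel_measurable_continuous_on_restrict) simp
    from measurable_compose[OF measurable_fst this]
    show "(\<lambda>x. weight (inv (fst x) ` T) / weight T)
        \<in> borel_measurable (restrict_space borel Sym \<Otimes>\<^sub>M Str_borel L)" .
  next
    show "(\<lambda>x. finite_marks (snd x)) \<in> restrict_space borel Sym \<Otimes>\<^sub>M Str_borel L \<rightarrow>\<^sub>M count_space {T. finite T}"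
      by (rule measurable_compose[OF measurable_snd measurable_finite_marks])
    show "countable {T :: nat set. finite T}" by (rule countable_Collect_finite)
  qed
  then show ?thesis by (simp add: cocycle_def case_prod_beta')
qed

lemma measurable_cocycle_fixed: "cocycle g \<in> borel_measurable (Str_borel L)"
proof -
  have "(\<lambda>M. (\<lambda>T. weight (inv g ` T) / weight T) (finite_marks M)) \<in> borel_measurable (Str_borel L)"
    by (rule measurable_compose[OF measurable_finite_marks]) simp
  then show ?thesis by (simp add: cocycle_def[abs_def])
qed

section \<open>The law of the random structure\<close>

definition law :: "('r, 'f) struct measure" where
  "law = distr omega (Str_borel L) limit"

lemma sets_law [simp]: "sets law = sets (Str_borel L)"
  by (simp add: law_def)

lemma space_law [simp]: "space law = Str L"
  by (simp add: law_def)

lemma prob_space_law: "prob_space law"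
  unfolding law_def by (intro prob_space.prob_space_distr prob_space_omega measurable_limit)

text \<open>Almost surely, acting on the limit amounts to moving the sample, whose law changes by an
  explicit density. This density factors through \<open>limit\<close> by way of the marks and
  therefore descends to the law of the structure.\<close>

lemma density_law:
  assumes g: "bij g"
  shows "density law (\<lambda>M. ennreal (cocycle g M)) = distr law (Str_borel L) (logic_act L g)"
proof -
  let ?r = "\<lambda>x :: nat list \<times> (nat \<Rightarrow> nat \<Rightarrow> nat). ennreal (weight (inv g ` set (fst x)) / weight (set (fst x)))"
  have AE_good_move: "AE x in omega. good (move g x)"
  proof -
    \<comment> \<open>The moved sample measure has a density with respect to the original one and so
      inherits its almost sure events.\<close>
    have "AE x in distr omega omega (move g). good x"
      unfolding distr_move[OF g]
      by (subst AE_density) (use AE_good measurable_compose[OF measurable_fst_omega] in \<open>auto elim: eventually_mono\<close>)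
    from AE_distrD[OF measurable_move this] show ?thesis .
  qed
  have "distr law (Str_borel L) (logic_act L g) = distr omega (Str_borel L) (logic_act L g \<circ> limit)"
    unfolding law_def by (rule distr_distr[OF measurable_logic_act measurable_limit])
  also have "\<dots> = distr omega (Str_borel L) (limit \<circ> move g)"
  proof (rule distr_cong_AE[OF refl refl])
    show "AE x in omega. (logic_act L g \<circ> limit) x = (limit \<circ> move g) x"
      using AE_good AE_good_move by eventually_elim (simp add: limit_move[OF g])
    show "logic_act L g \<circ> limit \<in> omega \<rightarrow>\<^sub>M Str_borel L" "limit \<circ> move g \<in> omega \<rightarrow>\<^sub>M Str_borel L"
      by (rule measurable_comp[OF measurable_limit measurable_logic_act],
          rule measurable_comp[OF measurable_move measurable_limit])
  qed
  also have "\<dots> = distr (distr omega omega (move g)) (Str_borel L) limit"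
    by (rule distr_distr[OF measurable_limit measurable_move, symmetric])
  also have "\<dots> = distr (density omega ?r) (Str_borel L) limit"
    by (simp only: distr_move[OF g])
  also have "density omega ?r = density omega (\<lambda>x. ennreal (cocycle g (limit x)))"
  proof (rule density_cong)
    show "?r \<in> borel_measurable omega" by (rule measurable_compose[OF measurable_fst_omega]) simp
    show "(\<lambda>x. ennreal (cocycle g (limit x))) \<in> borel_measurable omega"
      by (rule measurable_compose[OF measurable_compose[OF measurable_limit measurable_cocycle_fixed] measurable_ennreal])
    show "AE x in omega. ?r x = ennreal (cocycle g (limit x))"
      using AE_good by eventually_elim (simp add: cocycle_def finite_marks_limit)
  qed
  also have "distr \<dots> (Str_borel L) limit = density law (\<lambda>M. ennreal (cocycle g M))"
    unfolding law_def
    by (rule density_distr[symmetric, OF measurable_compose[OF measurable_cocycle_fixed measurable_ennreal] measurable_limit])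
  finally show ?thesis ..
qed

text \<open>The density is strictly positive everywhere, so the law and its translate are mutually
  absolutely continuous.\<close>

lemma null_sets_law_act:
  assumes g: "bij g" and B: "B \<in> sets (Str_borel L)"
  shows "B \<in> null_sets law \<longleftrightarrow> B \<in> null_sets (distr law (Str_borel L) (logic_act L g))"
proof -
  have m: "(\<lambda>M. ennreal (cocycle g M)) \<in> borel_measurable law"
    using measurable_compose[OF measurable_cocycle_fixed measurable_ennreal] by (simp add: law_def)
  have "B \<in> null_sets (density law (\<lambda>M. ennreal (cocycle g M))) \<longleftrightarrow> (AE M in law. M \<notin> B)"
    using B cocycle_pos[of g, THEN linorder_not_le[THEN iffD2]] by (simp add: null_sets_density_iff[OF m] ennreal_eq_0_iff)
  then show ?thesis
    using B AE_iff_null_sets[of B law] by (simp add: density_law[OF g])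
qed

lemma quasi_invariant_law: "quasi_invariant L law"
  unfolding quasi_invariant_def
proof (intro ballI)
  fix g B assume g: "g \<in> Sym" and B: "B \<in> sets (Str_borel L)"
  have bij: "bij g" using g by (simp add: Sym_def)
  have gB: "logic_act L g ` B \<in> sets (Str_borel L)" by (rule logic_act_image_sets[OF g B])
  have sub: "B \<subseteq> Str L" using sets.sets_into_space[OF B] by simp
  have inj: "M = M'" if "M \<in> Str L" "M' \<in> Str L" "logic_act L g M = logic_act L g M'" for M M'
  proof -
    have "inv g \<in> Sym" using bij by (simp add: Sym_def bij_imp_bij_inv)
    then have "logic_act L (inv g) (logic_act L g K) = logic_act L id K" for K
      using logic_act_comp[of "inv g" g L K] g bij by (simp add: bij_is_inj)
    then show ?thesis using logic_act_id[OF that(1)] logic_act_id[OF that(2)] that(3) by metis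
  qed
  have "logic_act L g -` logic_act L g ` B \<inter> space law = B"
  proof (intro equalityI subsetI)
    fix M assume "M \<in> logic_act L g -` logic_act L g ` B \<inter> space law"
    then obtain M' where "M' \<in> B" "logic_act L g M = logic_act L g M'" "M \<in> Str L"
      unfolding space_law by blast
    then show "M \<in> B" using inj sub by blast
  next
    fix M assume "M \<in> B"
    then show "M \<in> logic_act L g -` logic_act L g ` B \<inter> space law" using sub unfolding space_law by blast
  qed
  then have "emeasure (distr law (Str_borel L) (logic_act L g)) (logic_act L g ` B) = emeasure law B"
    using gB by (subst emeasure_distr) (simp_all add: law_def)
  moreover have "emeasure law (logic_act L g ` B) = 0 \<longleftrightarrow>
      emeasure (distr law (Str_borel L) (logic_act L g)) (logic_act L g ` B) = 0"
    using null_sets_law_act[OF bij gB] gB by (simp add: null_sets_def)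
  ultimately show "emeasure law B = 0 \<longleftrightarrow> emeasure law (logic_act L g ` B) = 0" by simp
qed

lemma AE_law_iso_class: "AE M in law. M \<in> iso_class L N"
proof -
  have "{M \<in> space (Str_borel L). M \<in> iso_class L N} = iso_class L N"
    by (auto simp: iso_class_def)
  then have "{M \<in> space (Str_borel L). M \<in> iso_class L N} \<in> sets (Str_borel L)"
    using iso_class_sets[OF countable_L N] by simp
  from AE_distr_iff[OF measurable_limit this] show ?thesis
    unfolding law_def by (simp add: limit_in_iso_class)
qed

text \<open>If an open set meeting the class were null, so would be its preimages under countably
  many permutations that are dense in \<open>Sym\<close>. The action is transitive on the class, and
  by local constancy one of these permutations moves a given copy of \<open>N\<close> into the open
  set, so the preimages cover the class, which has full measure.\<close>

lemma is_support_law: "is_support (Str_top L) law (iso_class L N)"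
  unfolding is_support_def
proof (intro conjI allI impI)
  show "iso_class L N \<subseteq> topspace (Str_top L)" by (auto simp: iso_class_def)
  show "AE M in law. M \<in> iso_class L N" by (rule AE_law_iso_class)
  fix U assume U: "openin (Str_top L) U" and ne: "U \<inter> iso_class L N \<noteq> {}"
  have Us: "U \<in> sets (Str_borel L)" by (rule sets_Str_open[OF U])
  obtain M where M: "M \<in> U" "M \<in> iso_class L N" using ne by blast
  obtain D where D: "countable D" "D \<subseteq> Sym"
    "\<And>h Z. h \<in> Sym \<Longrightarrow> finite Z \<Longrightarrow> \<exists>g\<in>D. \<forall>z\<in>Z. g z = h z"
    using countable_dense_Sym by blast
  show "emeasure law U > 0"
  proof (rule ccontr)
    assume "\<not> emeasure law U > 0"
    then have "U \<in> null_sets law" using Us by (simp add: null_sets_def)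
    have "logic_act L g -` U \<inter> space law \<in> null_sets law" if "g \<in> D" for g
    proof -
      have "bij g" using that D(2) by (auto simp: Sym_def)
      then have "U \<in> null_sets (distr law (Str_borel L) (logic_act L g))"
        using \<open>U \<in> null_sets law\<close> null_sets_law_act[OF _ Us] by blast
      moreover have m: "logic_act L g \<in> law \<rightarrow>\<^sub>M Str_borel L"
        using measurable_logic_act by (simp add: law_def)
      ultimately show ?thesis
        using emeasure_distr[OF m Us] measurable_sets[OF m Us] by (simp add: null_sets_def)
    qed
    then have "(\<Union>g\<in>D. logic_act L g -` U \<inter> space law) \<in> null_sets law"
      using D(1) by (intro null_sets_UN') auto
    from AE_not_in[OF this] AE_law_iso_class have "AE M in law. False"
    proof eventually_elim
      case (elim M')
      obtain h where h: "h \<in> Sym" "logic_act L h M' = M"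
        by (rule iso_class_transitive[OF M(2) elim(2)])
      have "logic_act L h M' \<in> U" using h(2) M(1) by simp
      from logic_act_locally_constant[OF U h(1) this] obtain Z where
        Z: "finite Z" "\<And>g. g \<in> Sym \<Longrightarrow> \<forall>z\<in>Z. g z = h z \<Longrightarrow> logic_act L g M' \<in> U" by blast
      obtain g where "g \<in> D" "\<forall>z\<in>Z. g z = h z" using D(3)[OF h(1) Z(1)] by blast
      moreover from this have "logic_act L g M' \<in> U" using D(2) Z(2) by blast
      moreover have "M' \<in> space law" using elim(2) by (simp add: iso_class_def)
      ultimately show False using elim(1) by blast
    qed
    then show False using prob_space.AE_False[OF prob_space_law] by simp
  qed
qed

lemma RN_cocycle_law: "RN_cocycle L law cocycle"
  unfolding RN_cocycle_def
proof (intro conjI ballI)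
  fix g assume "g \<in> Sym"
  then have g: "bij g" by (simp add: Sym_def)
  interpret law: prob_space law by (rule prob_space_law)
  have "(\<lambda>M. ennreal (cocycle g M)) \<in> borel_measurable law"
    using measurable_compose[OF measurable_cocycle_fixed measurable_ennreal] by (simp add: law_def)
  from law.RN_deriv_unique[OF this density_law[OF g]]
  show "AE M in law. RN_deriv law (distr law (Str_borel L) (logic_act L g)) M = ennreal (cocycle g M)"
    by eventually_elim simp
qed (rule measurable_cocycle cocycle_pos cocycle_comp; assumption)+

end

theorem theorem1p3:
  fixes L :: "('r, 'f) language" and N :: "('r, 'f) struct"
  assumes "countable_language L"
    and "N \<in> Str L"
    and "\<not> highly_algebraic L N"
  shows "\<exists>\<mu> c. prob_space \<mu> \<and> sets \<mu> = sets (Str_borel L) \<and>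
    is_support (Str_top L) \<mu> (iso_class L N) \<and>
    quasi_invariant L \<mu> \<and>
    RN_cocycle L \<mu> c \<and>
    (\<forall>M\<in>Str L. continuous_on Sym (\<lambda>g. c g M))"
proof -
  obtain fs A s where "staged L N fs A s" using staged_exists[OF assms] by blast
  then interpret staged L N fs A s .
  show ?thesis
    using prob_space_law sets_law is_support_law quasi_invariant_law RN_cocycle_law continuous_cocycle
    by blast
qed

end
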